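(* Let $G$ be a finite, simple, connected unicyclic graph. Then each of $\dim(G)$ and $\mathrm{edim}(G)$ equals either $L(G)+\max\{2-b(G),0\}$ or $L(G)+\max\{2-b(G),0\}+1$.
   Context: A unicyclic graph is a connected graph containing exactly one cycle $C$. For $v_i\in V(C)$, $T_{v_i}$ is the connected component of $G-E(C)$ containing $v_i$. $\dim(G)$ is the minimum size of a set $S\subseteq V(G)$ such that every two distinct vertices $u,v$ have some $s\in S$ with $d(u,s)\ne d(v,s)$; $\mathrm{edim}(G)$ is the minimum size of $S\subseteq V(G)$ such that every two distinct edges $e,f$ have some $s\in S$ with $d(e,s)\ne d(f,s)$, where $d(uv,s)=\min\{d(u,s),d(v,s)\}$. A thread is a path $u_1\cdots u_k$ in which all vertices have degree $2$ except $u_k$ which has degree $1$, and $u_1$ is adjacent to a vertex $v$ with $\deg(v)\ge3$ (the thread is attached to $v$). $\ell(v)$ is the number of threads attached to $v$, and $L(G)=\sum_{v\in V(G),\,\ell(v)>1}(\ell(v)-1)$. A vertex $v$ is branching if $v\notin V(C)$ and $\deg(v)\ge3$, or $v\in V(C)$ and $\deg(v)\ge 4$. A vertex $v_i\in V(C)$ is branch-active if $T_{v_i}$ contains a branching vertex, and $b(G)$ is the number of branch-active vertices on $C$. *)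

theory Defs
  imports Main
begin

datatype 'a ugraph = UGraph (verts: "'a set") (edges: "'a set set")

definition finite_simple_graph :: "'a ugraph \<Rightarrow> bool" where
  "finite_simple_graph G \<longleftrightarrow>
     finite (verts G) \<and> (\<forall>e\<in>edges G. \<exists>u\<in>verts G. \<exists>v\<in>verts G. u \<noteq> v \<and> e = {u, v})"

definition adj :: "'a ugraph \<Rightarrow> 'a \<Rightarrow> 'a \<Rightarrow> bool" where
  "adj G u v \<longleftrightarrow> {u, v} \<in> edges G"

definition degree :: "'a ugraph \<Rightarrow> 'a \<Rightarrow> nat" where
  "degree G v = card {e \<in> edges G. v \<in> e}"

definition walk :: "'a ugraph \<Rightarrow> 'a list \<Rightarrow> bool" where
  "walk G xs \<longleftrightarrow> xs \<noteq> [] \<and> set xs \<subseteq> verts G \<and> successively (adj G) xs"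

definition path :: "'a ugraph \<Rightarrow> 'a list \<Rightarrow> bool" where
  "path G xs \<longleftrightarrow> walk G xs \<and> distinct xs"

definition reachable :: "'a ugraph \<Rightarrow> 'a \<Rightarrow> 'a \<Rightarrow> bool" where
  "reachable G u v \<longleftrightarrow> (\<exists>xs. walk G xs \<and> hd xs = u \<and> last xs = v)"

definition connected_graph :: "'a ugraph \<Rightarrow> bool" where
  "connected_graph G \<longleftrightarrow>
     verts G \<noteq> {} \<and> (\<forall>u\<in>verts G. \<forall>v\<in>verts G. reachable G u v)"

definition component :: "'a ugraph \<Rightarrow> 'a \<Rightarrow> 'a ugraph" where
  "component G v = UGraph {u. reachable G v u} {e \<in> edges G. e \<subseteq> {u. reachable G v u}}"

(* Meaningful only for mutually reachable u and v; for other pairs the value of LEAST is unspecified. *)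
definition distance :: "'a ugraph \<Rightarrow> 'a \<Rightarrow> 'a \<Rightarrow> nat" where
  "distance G u v =
     (LEAST n. \<exists>xs. walk G xs \<and> hd xs = u \<and> last xs = v \<and> length xs = Suc n)"

definition edge_distance :: "'a ugraph \<Rightarrow> 'a set \<Rightarrow> 'a \<Rightarrow> nat" where
  "edge_distance G e s = Min ((\<lambda>u. distance G u s) ` e)"

definition vertex_metric_generator :: "'a ugraph \<Rightarrow> 'a set \<Rightarrow> bool" where
  "vertex_metric_generator G S \<longleftrightarrow> S \<subseteq> verts G \<and>
     (\<forall>u\<in>verts G. \<forall>v\<in>verts G. u \<noteq> v \<longrightarrow> (\<exists>s\<in>S. distance G u s \<noteq> distance G v s))"

definition edge_metric_generator :: "'a ugraph \<Rightarrow> 'a set \<Rightarrow> bool" where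
  "edge_metric_generator G S \<longleftrightarrow> S \<subseteq> verts G \<and>
     (\<forall>e\<in>edges G. \<forall>f\<in>edges G. e \<noteq> f \<longrightarrow>
        (\<exists>s\<in>S. edge_distance G e s \<noteq> edge_distance G f s))"

definition metric_dim :: "'a ugraph \<Rightarrow> nat" where
  "metric_dim G = (LEAST k. \<exists>S. vertex_metric_generator G S \<and> card S = k)"

definition edge_metric_dim :: "'a ugraph \<Rightarrow> nat" where
  "edge_metric_dim G = (LEAST k. \<exists>S. edge_metric_generator G S \<and> card S = k)"

(* A cycle is a subgraph, so that the rotations and reversals of a closed vertex sequence
   denote the same cycle. *)
definition is_cycle :: "'a ugraph \<Rightarrow> 'a ugraph \<Rightarrow> bool" where
  "is_cycle G C \<longleftrightarrow> (\<exists>xs. length xs \<ge> 3 \<and> path G xs \<and> adj G (last xs) (hd xs) \<and>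
     C = UGraph (set xs)
           (insert {last xs, hd xs} {{xs ! i, xs ! Suc i} | i. Suc i < length xs}))"

definition unicyclic :: "'a ugraph \<Rightarrow> bool" where
  "unicyclic G \<longleftrightarrow> connected_graph G \<and> (\<exists>!C. is_cycle G C)"

definition the_cycle :: "'a ugraph \<Rightarrow> 'a ugraph" where
  "the_cycle G = (THE C. is_cycle G C)"

definition cycle_component :: "'a ugraph \<Rightarrow> 'a \<Rightarrow> 'a ugraph" where
  "cycle_component G v = component (UGraph (verts G) (edges G - edges (the_cycle G))) v"

(* The list us runs from the vertex adjacent to v to the leaf. *)
definition thread_at :: "'a ugraph \<Rightarrow> 'a \<Rightarrow> 'a list \<Rightarrow> bool" where
  "thread_at G v us \<longleftrightarrow> path G us \<and> (\<forall>u\<in>set (butlast us). degree G u = 2) \<and>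
     degree G (last us) = 1 \<and> adj G (hd us) v \<and> degree G v \<ge> 3"

definition num_threads :: "'a ugraph \<Rightarrow> 'a \<Rightarrow> nat" where
  "num_threads G v = card {us. thread_at G v us}"

definition thread_sum :: "'a ugraph \<Rightarrow> nat" where
  "thread_sum G = (\<Sum>v\<in>{v \<in> verts G. num_threads G v > 1}. num_threads G v - 1)"

definition branching :: "'a ugraph \<Rightarrow> 'a \<Rightarrow> bool" where
  "branching G v \<longleftrightarrow> v \<in> verts G \<and>
     (v \<notin> verts (the_cycle G) \<and> degree G v \<ge> 3 \<or> v \<in> verts (the_cycle G) \<and> degree G v \<ge> 4)"

definition branch_active :: "'a ugraph \<Rightarrow> 'a \<Rightarrow> bool" where
  "branch_active G v \<longleftrightarrow> v \<in> verts (the_cycle G) \<and>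
     (\<exists>w\<in>verts (cycle_component G v). branching G w)"

definition num_branch_active :: "'a ugraph \<Rightarrow> nat" where
  "num_branch_active G = card {v. branch_active G v}"

end

(*
  Every edge off the cycle C hangs a tree on C, so distances split: from inside the subtree below r
  to outside of it one passes through r, and d(x, z) = h(x) + d_C + h(z) when x and z lie in
  different trees, where h is the distance to C.

  Lower bound: a generator S meets all but at most one of the threads at each vertex (the first
  vertices, resp. edges, of two unmet threads look alike from S), and S is not contained in a
  single tree (the two cycle neighbours of the root of that tree look alike). Threads counted by
  L(G) are pairwise disjoint and lie in trees at branch-active vertices.

  Upper bound: take all but one of the threads at each vertex with several threads. Then every
  branch-active tree is met, and adding 2 - b(G) cycle vertices makes S meet two trees; one
  more cycle vertex makes three roots with d(a, b) + d(b, c) + d(c, a) = |C|. Such a triple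
  determines the tree and the height of any vertex or edge. Two vertices of equal height in one tree
  branch off at some m; the two subtrees below m are not both unmet threads, and a subtree that is
  not a thread contains a vertex with two threads, hence meets S.
*)
theory Submission
  imports Defs
begin

section \<open>Distances in connected graphs\<close>

lemma walk_Cons: "walk G (x # xs) \<longleftrightarrow> x \<in> verts G \<and> (xs = [] \<or> adj G x (hd xs) \<and> walk G xs)"
  by (cases xs) (auto simp: walk_def)

lemma walk_rev: "walk G (rev xs) \<longleftrightarrow> walk G xs"
proof -
  have "successively (\<lambda>x y. adj G y x) xs \<longleftrightarrow> successively (adj G) xs"
    by (intro successively_cong) (auto simp: adj_def insert_commute)
  then show ?thesis by (simp add: walk_def)
qed

locale conn_graph =
  fixes G :: "'a ugraph"
  assumes simple: "finite_simple_graph G" and conn: "connected_graph G"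
begin

abbreviation "V \<equiv> verts G"
abbreviation "d \<equiv> distance G"

lemma finite_V: "finite V"
  using simple by (simp add: finite_simple_graph_def)

lemma adj_sym: "adj G u v \<Longrightarrow> adj G v u"
  by (simp add: adj_def insert_commute)

lemma adj_verts: assumes "adj G u v" shows "u \<in> V" "v \<in> V" "u \<noteq> v"
proof -
  obtain x y where "x \<in> V" "y \<in> V" "x \<noteq> y" "{u, v} = {x, y}"
    using assms simple unfolding adj_def finite_simple_graph_def by blast
  then show "u \<in> V" "v \<in> V" "u \<noteq> v" by (auto simp: doubleton_eq_iff)
qed

lemma edge_adj: assumes "e \<in> edges G" obtains u v where "e = {u, v}" "adj G u v"
proof -
  obtain x y where "e = {x, y}"
    using assms simple unfolding finite_simple_graph_def by blast
  with assms that show ?thesis by (simp add: adj_def)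
qed

lemma degree_eq_card_nbrs: "degree G v = card {u. adj G v u}"
proof -
  have "{e \<in> edges G. v \<in> e} = (\<lambda>u. {v, u}) ` {u. adj G v u}"
    by (auto elim!: edge_adj simp: adj_def insert_commute)
  moreover have "inj_on (\<lambda>u. {v, u}) {u. adj G v u}"
    by (auto simp: inj_on_def doubleton_eq_iff)
  ultimately show ?thesis by (simp add: degree_def card_image)
qed

lemma distance_walk:
  assumes "u \<in> V" "v \<in> V"
  shows "\<exists>xs. walk G xs \<and> hd xs = u \<and> last xs = v \<and> length xs = Suc (d u v)"
proof -
  obtain xs where "walk G xs" "hd xs = u" "last xs = v"
    using conn assms unfolding connected_graph_def reachable_def by blast
  moreover from this have "length xs = Suc (length xs - 1)" by (cases xs) (auto simp: walk_def)
  ultimately have "\<exists>n. \<exists>xs. walk G xs \<and> hd xs = u \<and> last xs = v \<and> length xs = Suc n" by blast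
  from LeastI_ex[OF this] show ?thesis unfolding distance_def .
qed

lemma distance_le: "walk G xs \<Longrightarrow> length xs = Suc k \<Longrightarrow> d (hd xs) (last xs) \<le> k"
  unfolding distance_def by (rule Least_le) auto

lemma distance_self [simp]: "u \<in> V \<Longrightarrow> d u u = 0"
  using distance_le[of "[u]" 0] by (simp add: walk_Cons)

lemma distance_sym: assumes "u \<in> V" "v \<in> V" shows "d u v = d v u"
proof -
  have "d u v \<le> d v u" if uv: "u \<in> V" "v \<in> V" for u v
  proof -
    obtain xs where "walk G xs" "hd xs = v" "last xs = u" "length xs = Suc (d v u)"
      using distance_walk[OF uv(2,1)] by blast
    then show ?thesis using distance_le[of "rev xs" "d v u"]
      by (simp add: walk_rev hd_rev last_rev)
  qed
  then show ?thesis using assms by (simp add: le_antisym)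
qed

lemma distance_adj_le: assumes "adj G u v" "s \<in> V" shows "d u s \<le> Suc (d v s)"
proof -
  obtain xs where xs: "walk G xs" "hd xs = v" "last xs = s" "length xs = Suc (d v s)"
    using distance_walk assms adj_verts(2) by blast
  then have "xs \<noteq> []" by auto
  with xs show ?thesis using distance_le[of "u # xs" "Suc (d v s)"] adj_verts[OF assms(1)] assms(1)
    by (simp add: walk_Cons)
qed

lemma distance_step:
  assumes "u \<in> V" "s \<in> V" "u \<noteq> s" obtains v where "adj G u v" "d u s = Suc (d v s)"
proof -
  obtain xs where xs: "walk G xs" "hd xs = u" "last xs = s" "length xs = Suc (d u s)"
    using distance_walk assms by blast
  then obtain y ys where ys: "xs = u # y # ys" using assms(3)
    by (cases xs; cases "tl xs") auto
  with xs have w: "walk G (y # ys)" "adj G u y" by (auto simp: walk_Cons)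
  have "d y s \<le> length ys" using distance_le[OF w(1), of "length ys"] xs ys by simp
  then have "d u s = Suc (d y s)"
    using distance_adj_le[OF w(2) assms(2)] xs ys by simp
  with w that show ?thesis by blast
qed

lemma distance_eq_0: assumes "u \<in> V" "s \<in> V" shows "d u s = 0 \<longleftrightarrow> u = s"
  using assms by (metis distance_self distance_step nat.distinct(1))

text \<open>Along a shortest walk such a function falls by at most 1 per edge. The explicit distance
  formulas below get their lower bounds from a suitable potential \<open>f\<close>.\<close>

lemma lipschitz_le_distance:
  fixes f :: "'a \<Rightarrow> int"
  assumes "\<And>x y. adj G x y \<Longrightarrow> f x \<le> f y + 1" "x \<in> V" "z \<in> V"
  shows "f x - f z \<le> int (d x z)"
  using assms(2)
proof (induction "d x z" arbitrary: x)
  case 0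
  then show ?case using distance_eq_0 assms(3) by force
next
  case (Suc k)
  then have "x \<noteq> z" using distance_eq_0 assms(3) by force
  then obtain y where "adj G x y" "d x z = Suc (d y z)"
    using distance_step Suc.prems assms(3) by blast
  then show ?case using Suc.hyps(1)[of y] Suc.hyps(2) assms(1)[of x y] adj_verts[of x y] by simp
qed

lemma distance_triangle:
  assumes "u \<in> V" "v \<in> V" "w \<in> V" shows "d u w \<le> d u v + d v w"
proof -
  have "int (d u w) - int (d v w) \<le> int (d u v)"
  proof (rule lipschitz_le_distance)
    show "int (d x w) \<le> int (d y w) + 1" if "adj G x y" for x y
      using distance_adj_le[OF that assms(3)] by simp
  qed (use assms in simp_all)
  then show ?thesis by simp
qed

lemma edge_distance_doubleton: "edge_distance G {u, v} s = min (d u s) (d v s)"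
  by (simp add: edge_distance_def)

end

section \<open>Distances on a cycle\<close>

text \<open>The length of the shorter arc between two positions in \<open>{0..<n}\<close> on a cycle
  of length \<open>n\<close>. Integers keep the subtraction untruncated.\<close>

definition cdist :: "int \<Rightarrow> int \<Rightarrow> int \<Rightarrow> int" where
  "cdist n i j = min \<bar>i - j\<bar> (n - \<bar>i - j\<bar>)"

lemma cdist_self [simp]: "0 \<le> n \<Longrightarrow> cdist n i i = 0"
  by (simp add: cdist_def)

lemma cdist_commute: "cdist n i j = cdist n j i"
  by (simp add: cdist_def abs_minus_commute)

lemma cdist_triangle:
  assumes "0 \<le> i" "i < n" "0 \<le> j" "j < n" "0 \<le> k" "k < n"
  shows "cdist n i k \<le> cdist n i j + cdist n j k"
  using assms unfolding cdist_def by linarith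

text \<open>The three shortest arcs tile the cycle. Equivalently, no arc between cyclically
  consecutive positions is longer than half the cycle.\<close>

definition geodesic_triple :: "int \<Rightarrow> int \<Rightarrow> int \<Rightarrow> int \<Rightarrow> bool" where
  "geodesic_triple n i j k \<longleftrightarrow> {i, j, k} \<subseteq> {0..<n} \<and> i \<noteq> j \<and> j \<noteq> k \<and> k \<noteq> i \<and>
     cdist n i j + cdist n j k + cdist n k i = n"

text \<open>Of the two arcs between \<open>i\<close> and \<open>j\<close>, the longer one has to be
  split into pieces of at most half the cycle.\<close>

lemma geodesic_triple_exists:
  assumes "n \<ge> 3" "0 \<le> i" "i < n" "0 \<le> j" "j < n" "i \<noteq> j"
  obtains k where "geodesic_triple n i j k"
proof -
  have *: "\<exists>k. geodesic_triple n i j k" if "0 \<le> i" "i < j" "j < n" for i j :: int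
  proof (cases "j - i \<le> n div 2")
    case True
    \<comment> \<open>\<open>m\<close> is the length of the first piece: at least 1, and large
      enough that the second piece \<open>n - (j - i) - m\<close> has length at most
      \<open>n div 2\<close>.\<close>
    define m where "m = max 1 (n - (j - i) - n div 2)"
    have m: "1 \<le> m" "m \<le> n div 2" "m < n - (j - i)" "n - (j - i) - m \<le> n div 2"
      using that True \<open>n \<ge> 3\<close> by (auto simp: m_def)
    have "geodesic_triple n i j (if j + m < n then j + m else j + m - n)"
      using that True m unfolding geodesic_triple_def cdist_def by (auto simp: min_def abs_if)
    then show ?thesis ..
  next
    case False
    \<comment> \<open>The arc from \<open>i\<close> to \<open>j\<close> is the long one, so the
      third position is put on it.\<close>
    with that \<open>n \<ge> 3\<close> have "geodesic_triple n i j (i + n div 2)"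
      unfolding geodesic_triple_def cdist_def by (auto simp: min_def abs_if)
    then show ?thesis ..
  qed
  have "\<exists>k. geodesic_triple n i j k"
  proof (cases "i < j")
    case True
    with * assms show ?thesis by blast
  next
    case False
    with * assms obtain k where "geodesic_triple n j i k" by force
    then have "geodesic_triple n i j k"
      unfolding geodesic_triple_def using cdist_commute by (auto simp: algebra_simps)
    then show ?thesis ..
  qed
  with that show ?thesis by blast
qed

text \<open>A point has the least possible distance sum to the ends of the arc that carries it,
  namely the length of that arc; this forces the offset \<open>k\<close> to vanish. Reflections then
  exclude distinct \<open>i\<close> and \<open>j\<close>. In the application \<open>k\<close> is a
  difference of heights.\<close>

lemma sorted_geodesic_triple_resolves:
  assumes "geodesic_triple N a b c" "a < b" "b < c"
    and ij: "0 \<le> i" "i < N" "0 \<le> j" "j < N"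
    and eq: "k + cdist N i a = cdist N j a" "k + cdist N i b = cdist N j b"
      "k + cdist N i c = cdist N j c"
  shows "i = j"
proof -
  have abc': "a < b" "b < c" "0 \<le> a" "c < N"
    using assms(1-3) by (auto simp: geodesic_triple_def)
  have "cdist N a b + cdist N b c + cdist N c a = N"
    using assms(1) by (simp add: geodesic_triple_def)
  moreover have "cdist N a b \<le> b - a" "cdist N b c \<le> c - b" "cdist N c a \<le> N - (c - a)"
    and "cdist N a b \<le> N - (b - a)" "cdist N b c \<le> N - (c - b)" "cdist N c a \<le> c - a"
    using abc' by (auto simp: cdist_def)
  \<comment> \<open>The sum reaches \<open>N\<close> only if each distance is the length of the arc
    between neighbours in cyclic order, so none of these arcs exceeds half the cycle.\<close>
  ultimately have "2 * (b - a) \<le> N" "2 * (c - b) \<le> N" "2 * (N - (c - a)) \<le> N"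
    by auto
  note abc' = abc' this
  have abc: "cdist N a b = b - a" "cdist N b c = c - b" "cdist N c a = N - (c - a)"
    using abc' unfolding cdist_def by (auto simp: min_def abs_if)
  have ab: "cdist N x a = x - a \<and> cdist N x b = b - x"
    if "a \<le> x" "x \<le> b" for x
    using that abc' unfolding cdist_def by (auto simp: min_def abs_if)
  have bc: "cdist N x b = x - b \<and> cdist N x c = c - x"
    if "b \<le> x" "x \<le> c" for x
    using that abc' unfolding cdist_def by (auto simp: min_def abs_if)
  have ca: "cdist N x c = x - c \<and> cdist N x a = N - x + a"
    if "c \<le> x" "x < N" for x
    using that abc' unfolding cdist_def by (auto simp: min_def abs_if)
  have ca': "cdist N x c = N + x - c \<and> cdist N x a = a - x"
    if "0 \<le> x" "x \<le> a" for x
    using that abc' unfolding cdist_def by (auto simp: min_def abs_if)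
  have arcs: "0 \<le> x \<and> x < a \<or> a \<le> x \<and> x < b \<or> b \<le> x \<and> x < c \<or> c \<le> x \<and> x < N" if "0 \<le> x" "x < N" for x
    using that by linarith
  have on_arc: "cdist N x a + cdist N x b = b - a \<or> cdist N x b + cdist N x c = c - b
     \<or> cdist N x c + cdist N x a = N - (c - a)" if "0 \<le> x" "x < N" for x
    using arcs[OF that] ab[of x] bc[of x] ca[of x] ca'[of x] by linarith
  have ge: "b - a \<le> cdist N x a + cdist N x b" "c - b \<le> cdist N x b + cdist N x c"
     "N - (c - a) \<le> cdist N x c + cdist N x a" if "0 \<le> x" "x < N" for x
    using that abc' unfolding cdist_def by (auto simp: min_def abs_if)
  \<comment> \<open>The arc that carries \<open>i\<close> gives \<open>k\<close> \<ge> 0, the arc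
    that carries \<open>j\<close> gives \<open>k\<close> \<le> 0.\<close>
  have "k = 0" using on_arc[OF ij(1,2)] on_arc[OF ij(3,4)] ge[OF ij(1,2)] ge[OF ij(3,4)] eq by linarith
  with eq have eq': "cdist N i a = cdist N j a" "cdist N i b = cdist N j b" "cdist N i c = cdist N j c"
    by auto
  \<comment> \<open>Distinct points at equal distance from \<open>t\<close> are mirror images in
    \<open>t\<close>, so \<open>i + j\<close> is congruent to \<open>2 * t\<close> modulo
    \<open>N\<close>. At most two positions \<open>t\<close> satisfy this, and the triple has
    three.\<close>
  have reflect: "i + j = 2 * t \<or> i + j = 2 * t + N \<or> i + j = 2 * t - N"
    if "i \<noteq> j" "cdist N i t = cdist N j t" "0 \<le> t" "t < N" for t
    using that ij unfolding cdist_def by (auto simp: min_def abs_if split: if_splits)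
  show ?thesis
  proof (rule ccontr)
    assume "i \<noteq> j"
    from reflect[OF this eq'(1)] reflect[OF this eq'(2)] reflect[OF this eq'(3)] abc'
    show False by auto
  qed
qed

text \<open>Inequalities are assumed because a landmark in the same tree as a vertex gives just an
  upper bound on its distance in terms of height and cycle position. The cases \<open>t = i\<close>
  and \<open>t = j\<close> are recovered from another member of the triple by the triangle
  inequality.\<close>

lemma geodesic_triple_resolves:
  assumes triple: "geodesic_triple N a b c" and ij: "0 \<le> i" "i < N" "0 \<le> j" "j < N"
    and ge: "\<And>t. t \<in> {a, b, c} \<Longrightarrow> t \<noteq> i \<Longrightarrow> k + cdist N i t \<le> cdist N j t"
    and le: "\<And>t. t \<in> {a, b, c} \<Longrightarrow> t \<noteq> j \<Longrightarrow> cdist N j t \<le> k + cdist N i t"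
  shows "i = j"
proof -
  have other: "\<exists>t'\<in>{a, b, c}. t' \<noteq> t \<and> 0 \<le> t' \<and> t' < N" for t
    using triple by (auto simp: geodesic_triple_def)
  have "k \<le> cdist N j i"
  proof -
    obtain t where t: "t \<in> {a, b, c}" "t \<noteq> i" "0 \<le> t" "t < N" using other by blast
    with ge[of t] cdist_triangle[of j N i t] ij show ?thesis by simp
  qed
  moreover have "- k \<le> cdist N i j"
  proof -
    obtain t where t: "t \<in> {a, b, c}" "t \<noteq> j" "0 \<le> t" "t < N" using other by blast
    with le[of t] cdist_triangle[of i N j t] ij show ?thesis by simp
  qed
  ultimately have "k + cdist N i t = cdist N j t" if "t \<in> {a, b, c}" for t
    using ge[OF that] le[OF that] ij by (cases "t = i"; cases "t = j") auto
  then have eq: "k + cdist N i a = cdist N j a" "k + cdist N i b = cdist N j b"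
      "k + cdist N i c = cdist N j c" by auto
  have rot: "geodesic_triple N y z x" and swap: "geodesic_triple N y x z"
    if "geodesic_triple N x y z" for x y z
    using that by (auto simp: geodesic_triple_def cdist_def abs_minus_commute)
  consider "a < b" "b < c" | "a < c" "c < b" | "b < a" "a < c" | "b < c" "c < a"
    | "c < a" "a < b" | "c < b" "b < a"
    using triple by (force simp: geodesic_triple_def)
  then show ?thesis
    by cases (use sorted_geodesic_triple_resolves ij eq triple rot swap in metis)+
qed

section \<open>Cycles with hanging trees\<close>

text \<open>Abstract form of a unicyclic graph: \<open>c\<close> runs around the cycle,
  \<open>par\<close> moves one edge towards it and \<open>h\<close> measures the height above it. As
  \<open>par\<close> fixes cycle vertices, its iterates stop there. By \<open>adj_cases\<close>
  every edge is a parent edge or joins consecutive cycle vertices.\<close>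

locale cycle_with_trees = conn_graph +
  fixes n :: nat and c :: "nat \<Rightarrow> 'a" and par :: "'a \<Rightarrow> 'a" and h :: "'a \<Rightarrow> nat"
  assumes n_ge_3: "n \<ge> 3"
    and inj_c: "inj_on c {..<n}"
    and c_adj: "i < n \<Longrightarrow> adj G (c i) (c (Suc i mod n))"
    and h_eq_0: "x \<in> verts G \<Longrightarrow> h x = 0 \<longleftrightarrow> x \<in> c ` {..<n}"
    and par: "x \<in> verts G \<Longrightarrow> x \<notin> c ` {..<n} \<Longrightarrow> adj G x (par x) \<and> h x = Suc (h (par x))"
    and par_cycle: "x \<in> c ` {..<n} \<Longrightarrow> par x = x"
    and adj_cases: "adj G x y \<Longrightarrow> x \<notin> c ` {..<n} \<and> par x = y \<or> y \<notin> c ` {..<n} \<and> par y = x \<or>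
      (\<exists>i<n. x = c i \<and> y = c (Suc i mod n) \<or> y = c i \<and> x = c (Suc i mod n))"
    and the_cycle: "the_cycle G = UGraph (c ` {..<n}) {{c i, c (Suc i mod n)} | i. i < n}"
begin

section \<open>Descendants, heights and the numbering of the hanging trees\<close>

abbreviation "C \<equiv> c ` {..<n}"

text \<open>The subtree hanging below \<open>r\<close>; for \<open>r\<close> on the cycle it is the
  whole tree at \<open>r\<close>. Accordingly \<open>idx x\<close> numbers the tree that contains
  \<open>x\<close>.\<close>

definition "desc r = {x \<in> V. \<exists>k. (par ^^ k) x = r}"
definition "idx x = (THE i. i < n \<and> x \<in> desc (c i))"
definition "children v = {u \<in> V - C. par u = v}"

lemma C_verts: "C \<subseteq> V"
  using c_adj adj_verts(1) by auto

lemma c_verts: "i < n \<Longrightarrow> c i \<in> V"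
  using C_verts by auto

lemma par_verts: "x \<in> V \<Longrightarrow> par x \<in> V"
  using par[of x] par_cycle[of x] adj_verts(2)[of x "par x"] by (cases "x \<in> C") auto

lemma h_par: "x \<in> V \<Longrightarrow> x \<notin> C \<Longrightarrow> h x = Suc (h (par x))"
  using par by blast

lemma h_par_le: "x \<in> V \<Longrightarrow> h (par x) \<le> h x"
  using h_par[of x] par_cycle[of x] by (cases "x \<in> C") auto

lemma h_C: "x \<in> C \<Longrightarrow> h x = 0"
  using h_eq_0[of x] C_verts by auto

lemma pow_par_verts: "x \<in> V \<Longrightarrow> (par ^^ k) x \<in> V"
  by (induction k) (auto simp: par_verts)

lemma h_pow_par_le: "x \<in> V \<Longrightarrow> h ((par ^^ k) x) \<le> h x"
  by (induction k) (auto intro: order_trans[OF h_par_le] pow_par_verts)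

lemma h_pow_par: "x \<in> V \<Longrightarrow> h ((par ^^ k) x) = h x - k"
proof (induction k)
  case (Suc k)
  have "(par ^^ k) x \<in> V" using Suc.prems by (rule pow_par_verts)
  then show ?case using Suc h_par[of "(par ^^ k) x"] h_C[of "(par ^^ k) x"] par_cycle[of "(par ^^ k) x"]
    by (cases "(par ^^ k) x \<in> C") auto
qed simp

lemma pow_par_C: "x \<in> C \<Longrightarrow> (par ^^ k) x = x"
  by (induction k) (auto simp: par_cycle)

lemma desc_verts: "x \<in> desc r \<Longrightarrow> x \<in> V" "x \<in> desc r \<Longrightarrow> r \<in> V"
  by (auto simp: desc_def pow_par_verts)

lemma desc_refl: "r \<in> V \<Longrightarrow> r \<in> desc r"
  unfolding desc_def by (auto intro: exI[of _ 0])

lemma desc_par: "x \<in> V \<Longrightarrow> par x \<in> desc r \<Longrightarrow> x \<in> desc r"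
  unfolding desc_def by (auto simp: funpow_swap1 intro: exI[of _ "Suc _"])

lemma h_desc_le: "x \<in> desc r \<Longrightarrow> h r \<le> h x"
  unfolding desc_def using h_pow_par_le by auto

lemma desc_cases:
  assumes "x \<in> desc r" obtains "x = r" | "x \<in> V" "x \<notin> C" "par x \<in> desc r"
proof -
  obtain k where k: "x \<in> V" "(par ^^ k) x = r" using assms by (auto simp: desc_def)
  consider "k = 0 \<or> x \<in> C" | k' where "k = Suc k'" "x \<notin> C" by (cases k) auto
  then show ?thesis
  proof cases
    case 1
    then have "x = r" using k pow_par_C[of x k] by auto
    then show ?thesis by (rule that(1))
  next
    case 2
    then have "par x \<in> desc r" using k par_verts by (auto simp: desc_def funpow_swap1)
    then show ?thesis by (rule that(2)[OF k(1) 2(2)])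
  qed
qed

lemma desc_trans: "x \<in> desc y \<Longrightarrow> y \<in> desc z \<Longrightarrow> x \<in> desc z"
  unfolding desc_def mem_Collect_eq by (metis comp_apply funpow_add)

text \<open>Both \<open>a\<close> and \<open>b\<close> are iterates of \<open>par\<close> at
  \<open>x\<close>, and the later iterate is an ancestor of the earlier one.\<close>

lemma desc_linear:
  assumes "x \<in> desc a" "x \<in> desc b" shows "a \<in> desc b \<or> b \<in> desc a"
proof -
  have *: "(par ^^ l) x \<in> desc ((par ^^ k) x)" if "k \<ge> l" "x \<in> V" for k l
  proof -
    have "(par ^^ k) x = (par ^^ (k - l)) ((par ^^ l) x)"
      using that by (metis comp_apply funpow_add le_add_diff_inverse2)
    then show ?thesis using that pow_par_verts by (auto simp: desc_def)
  qed
  obtain k l where "x \<in> V" "(par ^^ k) x = a" "(par ^^ l) x = b"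
    using assms by (auto simp: desc_def)
  with *[of k l] *[of l k] show ?thesis by (cases "k \<le> l") auto
qed

lemma desc_antisym: "x \<in> desc y \<Longrightarrow> h x \<le> h y \<Longrightarrow> x = y"
  by (metis desc_cases h_desc_le h_par not_less_eq_eq order_trans)

lemma desc_C: "x \<in> desc r \<Longrightarrow> x \<in> C \<Longrightarrow> x = r"
  by (auto simp: desc_def pow_par_C)

text \<open>Climbing \<open>h x\<close> times leads to height 0, that is to the cycle. Two such
  roots would be comparable, and a cycle vertex is a descendant of itself only.\<close>

lemma ex_idx: assumes "x \<in> V" shows "\<exists>!i. i < n \<and> x \<in> desc (c i)"
proof -
  have "(par ^^ h x) x \<in> C" using assms h_eq_0 h_pow_par[of x "h x"] pow_par_verts by auto
  then obtain i where i: "i < n" "x \<in> desc (c i)" using assms by (auto simp: desc_def)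
  moreover have "j = i" if "j < n" "x \<in> desc (c j)" for j
    using desc_linear[OF i(2) that(2)] desc_C[of "c i" "c j"] desc_C[of "c j" "c i"] inj_c i that
    by (auto simp: inj_on_def)
  ultimately show ?thesis by blast
qed

lemma idx_less: "x \<in> V \<Longrightarrow> idx x < n" and desc_idx: "x \<in> V \<Longrightarrow> x \<in> desc (c (idx x))"
  using theI'[OF ex_idx] unfolding idx_def by blast+

lemma idx_eq: "x \<in> desc (c i) \<Longrightarrow> i < n \<Longrightarrow> idx x = i"
  using ex_idx[of x] idx_less desc_idx desc_verts by blast

lemma idx_c: "i < n \<Longrightarrow> idx (c i) = i"
  using idx_eq desc_refl C_verts by blast

lemma idx_par: "x \<in> V \<Longrightarrow> idx (par x) = idx x"
  using idx_eq desc_par desc_idx idx_less par_verts by metis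

lemma idx_desc: "x \<in> desc r \<Longrightarrow> idx x = idx r"
  using idx_eq desc_trans desc_idx idx_less desc_verts by metis

lemma idx_adj: "adj G x y \<Longrightarrow> idx x = idx y \<or> Suc (idx x) mod n = idx y \<or> Suc (idx y) mod n = idx x"
  using adj_cases[of x y] adj_verts[of x y] idx_par idx_c n_ge_3 by auto

section \<open>Distances split at ancestors\<close>

lemma distance_pow_par_le: "x \<in> V \<Longrightarrow> r \<in> V \<Longrightarrow> x \<in> desc r \<Longrightarrow> d x r + h r \<le> h x"
proof (induction "h x" arbitrary: x rule: less_induct)
  case less
  from less.prems(3) show ?case
  proof (cases rule: desc_cases)
    case 2
    then show ?thesis
      using less.hyps[of "par x"] less.prems par par_verts distance_adj_le[of x "par x" r] by fastforce
  qed (use less.prems in simp)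
qed

text \<open>Every walk that leaves the subtree of \<open>r\<close> passes through \<open>r\<close>.
  The additive form avoids truncated subtraction, and the case \<open>z = r\<close> says that
  \<open>d x r\<close> is the difference of heights.\<close>

lemma distance_desc:
  assumes x: "x \<in> desc r" and z: "z \<in> V" "z \<notin> desc r \<or> z = r"
  shows "d x z + h r = h x + d r z"
proof -
  \<comment> \<open>The potential is the claimed distance to \<open>z\<close>: through
    \<open>r\<close> inside the subtree, the true distance outside.\<close>
  define f where "f y = (if y \<in> desc r then int (h y) - int (h r) + int (d r z) else int (d y z))" for y
  have r: "x \<in> V" "r \<in> V" using desc_verts x by auto
  have lip: "f u \<le> f v + 1" if uv: "adj G u v" for u v
  proof -
    note uv' = adj_verts[OF uv]
    have key: "f u \<le> f v + 1 \<and> f v \<le> f u + 1" if uv: "u \<in> V" "u \<notin> C" "v = par u" "adj G u v" for u v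
    \<comment> \<open>The parent edge of \<open>r\<close> is the one parent edge that crosses the
      border of the subtree; at both of its ends \<open>f\<close> is the true distance to
      \<open>z\<close>.\<close>
    proof (cases "u = r")
      case True
      then have "v \<notin> desc r" using h_desc_le h_par uv by fastforce
      then show ?thesis using True uv r distance_adj_le[OF uv(4) z(1)]
          distance_adj_le[OF adj_sym[OF uv(4)] z(1)] desc_refl by (simp add: f_def)
    next
      case False
      then have eq: "u \<in> desc r \<longleftrightarrow> v \<in> desc r" using uv desc_cases desc_par by metis
      then show ?thesis using uv h_par[of u] distance_adj_le[OF uv(4) z(1)]
          distance_adj_le[OF adj_sym[OF uv(4)] z(1)] by (simp add: f_def)
    qed
    have fC: "f u = int (d u z)" if "u \<in> C" for u
      using that desc_C[of u r] by (auto simp: f_def)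
    show ?thesis
      using adj_cases[OF uv]
    proof (elim disjE)
      assume "u \<notin> C \<and> par u = v" then show ?thesis using key[of u v] uv uv' by simp
    next
      assume "v \<notin> C \<and> par v = u" then show ?thesis using key[of v u] adj_sym uv uv' by simp
    next
      assume "\<exists>i<n. u = c i \<and> v = c (Suc i mod n) \<or> v = c i \<and> u = c (Suc i mod n)"
      then have "u \<in> C" "v \<in> C" by auto
      then show ?thesis using fC distance_adj_le[OF uv z(1)] by simp
    qed
  qed
  have "f z = 0" using z by (auto simp: f_def)
  with lipschitz_le_distance[of f x z, OF lip r(1) z(1)] have "int (h x) - int (h r) + int (d r z) \<le> int (d x z)"
    using x by (simp add: f_def)
  moreover have "d x z \<le> d x r + d r z" using distance_triangle r z by blast
  ultimately show ?thesis using distance_pow_par_le[OF r x] by linarith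
qed

text \<open>By \<open>distance_desc\<close> a first step to a child of \<open>r\<close> would
  increase the distance to \<open>z\<close>, so a shortest walk starts with the parent.\<close>

lemma distance_par:
  assumes "r \<in> V" "r \<notin> C" "z \<in> V" "z \<notin> desc r" shows "d r z = Suc (d (par r) z)"
proof -
  have "r \<noteq> z" using assms desc_refl by blast
  then obtain w where w: "adj G r w" "d r z = Suc (d w z)" using distance_step assms by metis
  have "par w \<noteq> r \<or> w \<in> C"
  proof (rule ccontr)
    assume *: "\<not> ?thesis"
    then have "w \<in> desc r" using desc_par[of w r] desc_refl assms adj_verts w by auto
    with * distance_desc[of w r z] assms h_par[of w] w adj_verts show False by force
  qed
  then have "w = par r" using adj_cases[OF w(1)] assms by auto
  with w show ?thesis by simp
qed

section \<open>Distances along the cycle and between different trees\<close>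

lemma cdist_Suc_mod_le:
  assumes "i < n" "j < n"
  shows "\<bar>cdist (int n) (int (Suc i mod n)) (int j) - cdist (int n) (int i) (int j)\<bar> \<le> 1"
  using assms n_ge_3 by (cases "Suc i = n") (auto simp: cdist_def min_def abs_if)

lemma distance_c_Suc_mod_le:
  assumes "i < n"
  shows "d (c i) (c ((i + k) mod n)) \<le> k"
proof (induction k)
  case 0
  then show ?case using assms C_verts by auto
next
  case (Suc k)
  let ?j = "(i + k) mod n"
  have j: "?j < n" using n_ge_3 by simp
  have "d (c i) (c (Suc ?j mod n)) \<le> d (c i) (c ?j) + d (c ?j) (c (Suc ?j mod n))"
    by (intro distance_triangle c_verts) (use assms j n_ge_3 in auto)
  also have "d (c ?j) (c (Suc ?j mod n)) \<le> 1"
    using distance_adj_le[OF c_adj[OF j], of "c (Suc ?j mod n)"] c_verts[of "Suc ?j mod n"] n_ge_3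
    by simp
  finally show ?case using Suc by (simp add: mod_Suc_eq)
qed

text \<open>Walking around either side gives the upper bound. For the lower bound, the cyclic
  distance from \<open>idx x\<close> to \<open>j\<close> is a 1-Lipschitz function on all of
  \<open>G\<close>, since adjacent vertices have equal or consecutive indices.\<close>

lemma distance_c:
  assumes "i < n" "j < n" shows "int (d (c i) (c j)) = cdist (int n) (int i) (int j)"
proof (rule antisym)
  have V: "c i \<in> V" "c j \<in> V" using C_verts assms by auto
  have *: "int (d (c i) (c j)) \<le> cdist (int n) (int i) (int j)" if "i \<le> j" "i < n" "j < n" for i j
  proof -
    have "d (c i) (c j) \<le> j - i" using distance_c_Suc_mod_le[of i "j - i"] that by simp
    moreover have "d (c j) (c i) \<le> n - (j - i)"
      using distance_c_Suc_mod_le[of j "n - (j - i)"] that by simp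
    moreover have "d (c j) (c i) = d (c i) (c j)" using distance_sym[OF c_verts c_verts] that by blast
    ultimately show ?thesis using that unfolding cdist_def by linarith
  qed
  show "int (d (c i) (c j)) \<le> cdist (int n) (int i) (int j)"
    using *[of i j] *[of j i] distance_sym[OF V] cdist_commute assms by (cases "i \<le> j") auto
  have "cdist (int n) (int (idx x)) (int j) \<le> cdist (int n) (int (idx y)) (int j) + 1" if xy: "adj G x y" for x y
    using idx_adj[OF xy] cdist_Suc_mod_le[of "idx x" j] cdist_Suc_mod_le[of "idx y" j]
      assms idx_less adj_verts[OF xy] by auto
  from lipschitz_le_distance[of "\<lambda>x. cdist (int n) (int (idx x)) (int j)", OF this V] show
    "cdist (int n) (int i) (int j) \<le> int (d (c i) (c j))" using assms by (simp add: idx_c)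
qed

lemma distance_root: "x \<in> V \<Longrightarrow> d x (c (idx x)) = h x"
  using distance_desc[OF desc_idx, of x "c (idx x)"] idx_less h_C C_verts by auto

text \<open>This holds within one tree as well, where the cycle term vanishes and the route through
  the root may be a detour.\<close>

lemma distance_le_idx:
  assumes "x \<in> V" "z \<in> V" shows "int (d x z) \<le> int (h x) + cdist (int n) (int (idx x)) (int (idx z)) + int (h z)"
proof -
  let ?a = "c (idx x)" and ?b = "c (idx z)"
  have ab: "?a \<in> V" "?b \<in> V" using c_verts idx_less assms by auto
  have "d x z \<le> d x ?a + d ?a z" "d ?a z \<le> d ?a ?b + d ?b z"
    using distance_triangle ab assms by auto
  then show ?thesis using distance_c[of "idx x" "idx z"] idx_less distance_root assms
      distance_sym[of ?b z] ab by (simp add: algebra_simps)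
qed

text \<open>\<open>distance_desc\<close> is applied at the roots of both trees.\<close>

lemma distance_idx:
  assumes "x \<in> V" "z \<in> V" "idx x \<noteq> idx z"
  shows "int (d x z) = int (h x) + cdist (int n) (int (idx x)) (int (idx z)) + int (h z)"
proof -
  let ?a = "c (idx x)" and ?b = "c (idx z)"
  have i: "idx x < n" "idx z < n" using idx_less assms by auto
  have ab: "?a \<in> V" "?b \<in> V" "h ?a = 0" "h ?b = 0" using c_verts i h_C by auto
  have "z \<notin> desc ?a" "?a \<notin> desc ?b" using idx_eq idx_c i assms(3) by metis+
  then have "d x z = h x + d ?a z" "d z ?a = h z + d ?b ?a"
    using distance_desc[OF desc_idx, of x z] distance_desc[OF desc_idx, of z ?a] assms ab by auto
  then show ?thesis using distance_c[OF i] distance_sym ab assms by simp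
qed

end

section \<open>Threads and branching vertices\<close>

context cycle_with_trees
begin

text \<open>Nothing branches below \<open>u\<close>: the subtree is a path down to a leaf, the shape
  of a thread.\<close>

definition "pathlike u \<longleftrightarrow> (\<forall>x\<in>desc u. card (children x) \<le> 1)"
text \<open>A thread is represented by its first vertex; the degree condition on \<open>v\<close>
  enters in \<open>num_threads_eq\<close>.\<close>

definition "thread_heads v = {u \<in> children v. pathlike u}"

text \<open>A thread read away from the cycle. Since the next vertex is always the only child, the
  head determines the list.\<close>

fun descending :: "'a list \<Rightarrow> bool" where
  "descending [] \<longleftrightarrow> False"
| "descending [u] \<longleftrightarrow> children u = {}"
| "descending (u # v # us) \<longleftrightarrow> children u = {v} \<and> descending (v # us)"

section \<open>Degrees in terms of children\<close>

lemma children_D: "u \<in> children v \<Longrightarrow> u \<in> V \<and> u \<notin> C \<and> par u = v \<and> v \<in> V \<and> h u = Suc (h v) \<and> adj G u v"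
  using par[of u] par_verts[of u] by (auto simp: children_def)

lemma children_I: "u \<in> V \<Longrightarrow> u \<notin> C \<Longrightarrow> u \<in> children (par u)"
  by (simp add: children_def)

lemma finite_children: "finite (children v)"
  by (rule finite_subset[OF _ finite_V]) (auto simp: children_def)

lemma adj_children: "adj G x y \<Longrightarrow> x \<in> children y \<and> par x = y \<or> y \<in> children x \<or> x \<in> C \<and> y \<in> C"
  using adj_cases[of x y] adj_verts[of x y] n_ge_3 unfolding children_def by force

lemma degree_not_C: assumes "v \<in> V" "v \<notin> C" shows "degree G v = Suc (card (children v))"
proof -
  have "adj G v u \<longleftrightarrow> u \<in> insert (par v) (children v)" for u
    using adj_children[of v u] assms par[of v] children_D[of u v] adj_sym[of u v] by blast
  then have "{u. adj G v u} = insert (par v) (children v)" by blast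
  moreover have "par v \<notin> children v"
    using children_D[of "par v" v] h_par[of v] assms by auto
  ultimately show ?thesis using finite_children by (simp add: degree_eq_card_nbrs)
qed

lemma degree_C: assumes "v \<in> C" shows "degree G v = 2 + card (children v)"
proof -
  obtain i where i: "i < n" "v = c i" using assms by auto
  \<comment> \<open>The predecessor of \<open>i\<close> in cyclic order.\<close>
  define j where "j = (if i = 0 then n - 1 else i - 1)"
  have j: "j < n" "Suc j mod n = i" using i n_ge_3 by (auto simp: j_def)
  have ji: "j \<noteq> Suc i mod n" using i n_ge_3 by (cases "Suc i = n") (auto simp: j_def)
  have uniq: "k = j" if "k < n" "Suc k mod n = i" for k
    using that j i by (cases "Suc k = n"; cases "Suc j = n") auto
  have iff: "adj G v u \<longleftrightarrow> u \<in> {c j, c (Suc i mod n)} \<union> children v" for u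
  proof
    assume u: "adj G v u"
    from adj_cases[OF u] show "u \<in> {c j, c (Suc i mod n)} \<union> children v"
    proof (elim disjE exE conjE)
      fix k assume k: "k < n" "u = c k" "v = c (Suc k mod n)"
      then have "Suc k mod n = i" using i inj_c n_ge_3 by (auto simp: inj_on_def)
      then show ?thesis using uniq k by blast
    next
      fix k assume k: "k < n" "v = c k" "u = c (Suc k mod n)"
      then have "k = i" using i inj_c by (auto simp: inj_on_def)
      then show ?thesis using k by blast
    qed (use assms u adj_verts[OF u] in \<open>auto simp: children_def\<close>)
  next
    assume "u \<in> {c j, c (Suc i mod n)} \<union> children v"
    then show "adj G v u"
      using c_adj[OF i(1)] c_adj[OF j(1)] j i children_D[of u v] adj_sym by auto
  qed
  then have "{u. adj G v u} = {c j, c (Suc i mod n)} \<union> children v" by blast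
  moreover have "c j \<noteq> c (Suc i mod n)" using inj_c j ji n_ge_3 by (auto simp: inj_on_def)
  moreover have "{c j, c (Suc i mod n)} \<inter> children v = {}"
    using j n_ge_3 by (auto simp: children_def)
  ultimately show ?thesis using finite_children
    by (simp add: degree_eq_card_nbrs card_Un_disjoint)
qed

lemma desc_children: "u \<in> V \<Longrightarrow> desc u = insert u (\<Union>w\<in>children u. desc w)"
proof (intro equalityI subsetI)
  fix x assume "x \<in> desc u"
  then show "x \<in> insert u (\<Union>w\<in>children u. desc w)"
  proof (induction "h x" arbitrary: x rule: less_induct)
    case less
    from less.prems show ?case
    proof (cases rule: desc_cases)
      case 2
      from less.hyps[of "par x"] 2 h_par[of x] have "par x \<in> insert u (\<Union>w\<in>children u. desc w)" by simp
      then show ?thesis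
        using 2 desc_refl[of x] desc_par[of x] children_I[of x] by auto
    qed simp
  qed
next
  fix x assume "u \<in> V" "x \<in> insert u (\<Union>w\<in>children u. desc w)"
  then show "x \<in> desc u"
    using desc_refl[of u] desc_trans desc_par children_D by blast
qed

lemma child_in_desc: "w \<in> children u \<Longrightarrow> w \<in> desc u"
  using desc_par desc_refl children_D by metis

lemma not_in_desc_child: "w \<in> children u \<Longrightarrow> u \<notin> desc w"
  using h_desc_le[of u w] children_D by fastforce

lemma finite_desc: "finite (desc u)"
  by (rule finite_subset[OF _ finite_V]) (auto simp: desc_def)

section \<open>Threads as descending paths\<close>

lemma descending_path:
  "descending us \<Longrightarrow> hd us \<in> children v \<Longrightarrow>
     path G us \<and> (\<forall>u\<in>set (butlast us). degree G u = 2) \<and> degree G (last us) = 1 \<and> set us = desc (hd us)"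
proof (induction us arbitrary: v rule: descending.induct)
  case (2 u)
  then show ?case
    using children_D[of u v] degree_not_C[of u] desc_children[of u] by (auto simp: path_def walk_Cons)
next
  case (3 u w us)
  then have w: "w \<in> children u" "children u = {w}" and u: "u \<in> V" "u \<notin> C"
    using children_D[of u v] by auto
  have "descending (w # us)" "hd (w # us) \<in> children u" using 3(2) w by simp_all
  from "3.IH"[OF this] have IH: "path G (w # us)" "\<forall>u\<in>set (butlast (w # us)). degree G u = 2"
    "degree G (last (w # us)) = 1" "set (w # us) = desc w" unfolding list.sel by blast+
  have "u \<notin> set (w # us)" using IH(4) not_in_desc_child[OF w(1)] by blast
  moreover have "degree G u = 2" using degree_not_C u w by simp
  moreover have "adj G u w" using children_D w(1) adj_sym by blast
  moreover have "desc u = insert u (set (w # us))" using desc_children[OF u(1)] w IH(4) by simp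
  ultimately show ?case using IH u by (auto simp: path_def walk_Cons)
qed simp

text \<open>A cycle vertex has degree at least 2, and at least 3 if it has a child, so a thread
  stays off the cycle. Degree 2 then leaves the next vertex of the list as the only child and makes
  the preceding vertex \<open>v\<close> the parent.\<close>

lemma thread_descending:
  "walk G us \<Longrightarrow> distinct us \<Longrightarrow> \<forall>u\<in>set (butlast us). degree G u = 2 \<Longrightarrow> degree G (last us) = 1 \<Longrightarrow>
    adj G (hd us) v \<Longrightarrow> v \<notin> set us \<Longrightarrow> hd us \<in> children v \<and> descending us"
proof (induction us arbitrary: v rule: descending.induct)
  case 1
  then show ?case by (simp add: walk_def)
next
  case (2 u)
  then have u: "u \<in> V" "u \<notin> C" using degree_C[of u] by (auto simp: walk_Cons)
  then have *: "children u = {}" using 2 degree_not_C[of u] finite_children[of u] by simp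
  then have "v \<notin> children u" by simp
  then have "par u = v" using adj_children[of u v] 2(5) u by auto
  with * u show ?case by (simp add: children_def)
next
  case (3 u w us)
  then have w: "w \<in> children u" "descending (w # us)"
    using adj_sym by (auto simp: walk_Cons)
  have uV: "u \<in> V" using 3 by (simp add: walk_Cons)
  have deg: "degree G u = 2" using 3 by simp
  have "card (children u) > 0" using w finite_children by (auto simp: card_gt_0_iff)
  then have u: "u \<notin> C" using degree_C[of u] deg by auto
  then have "card (children u) = 1" using degree_not_C deg uV by simp
  then have *: "children u = {w}" using w by (auto simp: card_1_singleton_iff)
  moreover have "v \<noteq> w" using 3 by auto
  ultimately have "v \<notin> children u" by simp
  then have "par u = v" using adj_children[of u v] 3(6) u by auto
  then show ?case using * w u uV by (simp add: children_def)
qed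

lemma descending_unique: "descending us \<Longrightarrow> descending ws \<Longrightarrow> hd us = hd ws \<Longrightarrow> us = ws"
proof (induction us arbitrary: ws rule: descending.induct)
  case (2 u)
  then show ?case by (cases ws rule: descending.cases) auto
next
  case (3 u v us)
  from 3(3,4) obtain ws' where ws': "ws = u # v # ws'" "descending (v # ws')"
    using 3(2) by (cases ws rule: descending.cases) auto
  then show ?case using "3.IH"[of "v # ws'"] 3(2) by simp
qed simp

lemma descending_pathlike: "descending us \<Longrightarrow> hd us \<in> V \<Longrightarrow> pathlike (hd us)"
proof (induction us rule: descending.induct)
  case (2 u)
  then show ?case using desc_children[of u] by (auto simp: pathlike_def)
next
  case (3 u v us)
  then have "v \<in> V" using children_D[of v u] by simp
  with 3 show ?case using desc_children[of u] by (auto simp: pathlike_def)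
qed simp

lemma pathlike_descending: "u \<in> V \<Longrightarrow> pathlike u \<Longrightarrow> \<exists>us. descending us \<and> hd us = u"
proof (induction "card (desc u)" arbitrary: u rule: less_induct)
  case less
  show ?case
  proof (cases "children u = {}")
    case True
    then have "descending [u]" by simp
    then show ?thesis by (metis list.sel(1))
  next
    case False
    have "card (children u) \<le> 1" using less.prems desc_refl by (auto simp: pathlike_def)
    with False finite_children[of u] obtain v where v: "children u = {v}"
      by (metis card_1_singletonE card_eq_0_iff le_neq_implies_less less_one)
    have "desc v \<subset> desc u"
      using desc_children[OF less.prems(1)] v not_in_desc_child[of v u] by auto
    then have "card (desc v) < card (desc u)" "desc v \<subseteq> desc u"
      using finite_desc psubset_card_mono by auto
    moreover have "v \<in> V" using v children_D[of v u] by simp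
    moreover have "pathlike v" using less.prems(2) \<open>desc v \<subseteq> desc u\<close> by (auto simp: pathlike_def)
    ultimately obtain us where "descending us" "hd us = v" using less.hyps by blast
    then have "descending (u # us)" using v by (cases us) auto
    then show ?thesis by (metis list.sel(1))
  qed
qed

lemma thread_at_iff:
  assumes "degree G v \<ge> 3"
  shows "thread_at G v us \<longleftrightarrow> descending us \<and> hd us \<in> children v"
proof
  assume t: "thread_at G v us"
  have "v \<notin> set us"
  proof
    assume "v \<in> set us"
    then have "v \<in> set (butlast us) \<or> v = last us"
      by (cases us rule: rev_cases) auto
    with t assms show False by (auto simp: thread_at_def)
  qed
  with t thread_descending show "descending us \<and> hd us \<in> children v"
    by (auto simp: thread_at_def path_def)
next
  assume "descending us \<and> hd us \<in> children v"
  with assms descending_path[of us v] children_D[of "hd us" v] show "thread_at G v us"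
    by (auto simp: thread_at_def)
qed

lemma num_threads_eq:
  "num_threads G v = (if degree G v \<ge> 3 then card (thread_heads v) else 0)"
proof (cases "degree G v \<ge> 3")
  case True
  have "hd ` {us. thread_at G v us} = thread_heads v"
  proof (intro equalityI subsetI)
    fix u assume "u \<in> thread_heads v"
    then have u: "u \<in> children v" "pathlike u" by (auto simp: thread_heads_def)
    then obtain us where "descending us" "hd us = u" using pathlike_descending children_D by blast
    then show "u \<in> hd ` {us. thread_at G v us}" using u thread_at_iff[OF True] by auto
  qed (use thread_at_iff[OF True] descending_pathlike children_D in \<open>auto simp: thread_heads_def\<close>)
  moreover have "inj_on hd {us. thread_at G v us}"
    using thread_at_iff[OF True] descending_unique by (auto simp: inj_on_def)
  ultimately show ?thesis using True by (simp add: num_threads_def card_image[symmetric])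
next
  case False
  then show ?thesis by (simp add: num_threads_def thread_at_def)
qed

lemma thread_heads_children: "thread_heads v \<subseteq> children v"
  by (auto simp: thread_heads_def)

lemma finite_thread_heads: "finite (thread_heads v)"
  by (rule finite_subset[OF thread_heads_children finite_children])

text \<open>Two children give degree at least 3 off the cycle and at least 4 on it.\<close>

lemma num_threads_gt_1:
  assumes "v \<in> V"
  shows "num_threads G v > 1 \<longleftrightarrow> card (thread_heads v) > 1"
    and "card (thread_heads v) > 1 \<Longrightarrow> num_threads G v = card (thread_heads v)"
proof -
  have "degree G v \<ge> 3" if "card (thread_heads v) > 1"
    using that card_mono[OF finite_children thread_heads_children, of v] degree_C[of v] degree_not_C[of v] assms
    by (cases "v \<in> C") auto
  then show "num_threads G v > 1 \<longleftrightarrow> card (thread_heads v) > 1"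
    and "card (thread_heads v) > 1 \<Longrightarrow> num_threads G v = card (thread_heads v)"
    by (auto simp: num_threads_eq)
qed

section \<open>Forks, branching vertices and branch-active trees\<close>

definition "forks = {v \<in> V. card (thread_heads v) > 1}"

lemma thread_sum_eq: "thread_sum G = (\<Sum>v\<in>forks. card (thread_heads v) - 1)"
  unfolding thread_sum_def forks_def using num_threads_gt_1 by (intro sum.cong) auto

text \<open>The thresholds 3 and 4 both amount to two children, because the degree exceeds the
  number of children by 1 off the cycle and by 2 on it.\<close>

lemma branching_iff: "branching G v \<longleftrightarrow> v \<in> V \<and> card (children v) \<ge> 2"
  using degree_C[of v] degree_not_C[of v] by (cases "v \<in> C") (auto simp: branching_def the_cycle)

text \<open>Deleting the cycle edges leaves the parent edges, along which \<open>idx\<close> is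
  constant. Conversely, parents lead from each vertex of \<open>desc v\<close> to
  \<open>v\<close>.\<close>

lemma verts_cycle_component:
  assumes "v \<in> C" shows "verts (cycle_component G v) = desc v"
proof -
  define H where "H = UGraph V (edges G - edges (the_cycle G))"
  obtain i where i: "i < n" "v = c i" using assms by auto
  have adj_H: "idx x = idx y" if "adj H x y" for x y
  proof -
    have "adj G x y" "{x, y} \<notin> edges (the_cycle G)" using that by (auto simp: H_def adj_def)
    then show ?thesis using adj_cases[of x y] idx_par adj_verts[of x y]
      by (auto simp: the_cycle insert_commute)
  qed
  have "last xs \<in> V \<and> idx (last xs) = idx (hd xs)" if "walk H xs" for xs
    using that
  proof (induction xs)
    case (Cons x xs)
    then show ?case using adj_H[of x "hd xs"] by (auto simp: walk_Cons H_def)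
  qed (simp add: walk_def)
  then have "x \<in> desc v" if "reachable H v x" for x
    using that desc_idx[of x] idx_c i unfolding reachable_def by metis
  moreover have "reachable H v x" if "x \<in> desc v" for x
    using that
  proof (induction "h x" arbitrary: x rule: less_induct)
    case less
    from less.prems show ?case
    proof (cases rule: desc_cases)
      case 1
      then have "walk H [x]" using assms C_verts by (auto simp: walk_Cons H_def)
      then show ?thesis unfolding reachable_def using 1 by (metis last.simps list.sel(1))
    next
      case 2
      then obtain xs where xs: "walk H xs" "hd xs = v" "last xs = par x"
        using less.hyps[of "par x"] h_par by (auto simp: reachable_def)
      have "x \<notin> \<Union> (edges (the_cycle G))"
        using 2(2) n_ge_3 by (auto simp: the_cycle)
      then have "adj H (par x) x" using par[of x] 2 adj_sym by (auto simp: adj_def H_def)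
      then have "walk H (xs @ [x])"
        using xs 2 by (auto simp: walk_def successively_append_iff H_def)
      moreover have "hd (xs @ [x]) = v" using xs by (auto simp: walk_def)
      ultimately show ?thesis unfolding reachable_def by (metis last_snoc)
    qed
  qed
  ultimately show ?thesis by (auto simp: cycle_component_def component_def H_def)
qed

lemma branch_active_iff:
  "branch_active G v \<longleftrightarrow> v \<in> C \<and> (\<exists>w\<in>desc v. card (children w) \<ge> 2)"
  using verts_cycle_component[of v] branching_iff desc_verts
  by (auto simp: branch_active_def the_cycle)

end

section \<open>Bounds for generators\<close>

context cycle_with_trees
begin

section \<open>Necessary conditions on generators\<close>

definition "hits_threads S \<longleftrightarrow> S \<subseteq> V \<and>
  (\<forall>v. \<forall>u\<in>thread_heads v. \<forall>w\<in>thread_heads v. u \<noteq> w \<longrightarrow> S \<inter> desc u \<noteq> {} \<or> S \<inter> desc w \<noteq> {})"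

text \<open>For \<open>S\<close> inside \<open>verts G\<close> this means that \<open>S\<close>
  meets at least two of the hanging trees.\<close>

definition "biactive S \<longleftrightarrow> (\<forall>i<n. \<exists>s\<in>S. idx s \<noteq> i)"

lemma thread_heads_distance:
  assumes "u \<in> thread_heads v" "s \<in> V" "s \<notin> desc u" shows "d u s = Suc (d v s)"
  using assms distance_par[of u s] children_D[of u v] thread_heads_children by blast

lemma distance_c_vertex:
  assumes "i < n" "s \<in> V"
  shows "int (d (c i) s) = cdist (int n) (int i) (int (idx s)) + int (h s)"
  using distance_idx[of "c i" s] distance_root[of s] distance_sym[of "c i" s] assms c_verts[of i]
    idx_c[of i] h_C[of "c i"] by (cases "idx s = i") auto

lemma cycle_neighbours:
  assumes "i < n"
  obtains j k where "j < n" "k < n" "j \<noteq> k" "Suc j mod n = i" "k = Suc i mod n"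
    "cdist (int n) (int j) (int i) = 1" "cdist (int n) (int k) (int i) = 1"
proof
  let ?j = "if i = 0 then n - 1 else i - 1" and ?k = "if Suc i = n then 0 else Suc i"
  show "?j < n" "?k < n" "?j \<noteq> ?k" "Suc ?j mod n = i" "?k = Suc i mod n"
    "cdist (int n) (int ?j) (int i) = 1" "cdist (int n) (int ?k) (int i) = 1"
    using assms n_ge_3 by (auto simp: cdist_def of_nat_diff)
qed

text \<open>From a landmark outside two threads at \<open>v\<close>, both heads are one step further
  away than \<open>v\<close>. From a landmark in tree \<open>i\<close>, both cycle neighbours of
  \<open>c i\<close> are one step further away than \<open>c i\<close>.\<close>

lemma vertex_generator_hits:
  assumes "vertex_metric_generator G S" shows "hits_threads S" "biactive S"
proof -
  from assms have S: "S \<subseteq> V"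
    and gen: "\<And>u v. u \<in> V \<Longrightarrow> v \<in> V \<Longrightarrow> u \<noteq> v \<Longrightarrow> \<exists>s\<in>S. d u s \<noteq> d v s"
    by (auto simp: vertex_metric_generator_def)
  show "hits_threads S"
    unfolding hits_threads_def
  proof (intro conjI S allI ballI impI)
    fix v u w assume u: "u \<in> thread_heads v" "w \<in> thread_heads v" "u \<noteq> w"
    then have "u \<in> V" "w \<in> V" using thread_heads_children children_D by blast+
    with gen u obtain s where "s \<in> S" "d u s \<noteq> d w s" by blast
    with subsetD[OF S \<open>s \<in> S\<close>] have "s \<in> desc u \<or> s \<in> desc w"
      using thread_heads_distance[OF u(1)] thread_heads_distance[OF u(2)] by metis
    with \<open>s \<in> S\<close> show "S \<inter> desc u \<noteq> {} \<or> S \<inter> desc w \<noteq> {}" by blast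
  qed
  show "biactive S"
    unfolding biactive_def
  proof (intro allI impI)
    fix i assume "i < n"
    then obtain j k where jk: "j < n" "k < n" "j \<noteq> k"
      "cdist (int n) (int j) (int i) = 1" "cdist (int n) (int k) (int i) = 1"
      using cycle_neighbours by metis
    then have "c j \<noteq> c k" using inj_c by (auto simp: inj_on_def)
    with gen jk c_verts obtain s where "s \<in> S" "d (c j) s \<noteq> d (c k) s" by blast
    with jk distance_c_vertex[of j s] distance_c_vertex[of k s] subsetD[OF S \<open>s \<in> S\<close>]
    show "\<exists>s\<in>S. idx s \<noteq> i" by (intro bexI[of _ s]) auto
  qed
qed

text \<open>The pairs of vertices are replaced by pairs of edges with a common end: the first edges
  of two threads at \<open>v\<close>, and the two cycle edges at \<open>c i\<close>.\<close>

lemma edge_generator_hits: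
  assumes "edge_metric_generator G S" shows "hits_threads S" "biactive S"
proof -
  from assms have S: "S \<subseteq> V"
    and gen: "\<And>u v w. adj G u v \<Longrightarrow> adj G w v \<Longrightarrow> u \<noteq> w \<Longrightarrow>
      \<exists>s\<in>S. min (d u s) (d v s) \<noteq> min (d w s) (d v s)"
    unfolding edge_metric_generator_def adj_def
    using edge_distance_doubleton by (metis doubleton_eq_iff)+
  show "hits_threads S"
    unfolding hits_threads_def
  proof (intro conjI S allI ballI impI)
    fix v u w assume u: "u \<in> thread_heads v" "w \<in> thread_heads v" "u \<noteq> w"
    then have "adj G u v" "adj G w v" using thread_heads_children children_D by blast+
    with gen u obtain s where "s \<in> S" "min (d u s) (d v s) \<noteq> min (d w s) (d v s)" by blast
    with subsetD[OF S \<open>s \<in> S\<close>] have "s \<in> desc u \<or> s \<in> desc w"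
      using thread_heads_distance[OF u(1)] thread_heads_distance[OF u(2)] by metis
    with \<open>s \<in> S\<close> show "S \<inter> desc u \<noteq> {} \<or> S \<inter> desc w \<noteq> {}" by blast
  qed
  show "biactive S"
    unfolding biactive_def
  proof (intro allI impI)
    fix i assume i: "i < n"
    then obtain j k where jk: "j < n" "k < n" "j \<noteq> k" "Suc j mod n = i" "k = Suc i mod n"
      "cdist (int n) (int j) (int i) = 1" "cdist (int n) (int k) (int i) = 1"
      using cycle_neighbours by metis
    then have "c j \<noteq> c k" using inj_c by (auto simp: inj_on_def)
    moreover have "adj G (c j) (c i)" "adj G (c k) (c i)"
      using jk c_adj[of j] c_adj[OF i] adj_sym by auto
    ultimately obtain s where s: "s \<in> S" "min (d (c j) s) (d (c i) s) \<noteq> min (d (c k) s) (d (c i) s)"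
      using gen by blast
    have "d (c j) s = d (c k) s" if "idx s = i"
      using subsetD[OF S s(1)] s jk distance_c_vertex[of j s] distance_c_vertex[of k s] that by auto
    with s show "\<exists>s\<in>S. idx s \<noteq> i" by (intro bexI[of _ s]) auto
  qed
qed

section \<open>Counting the landmarks that are forced\<close>

definition "active = {i. i < n \<and> branch_active G (c i)}"

lemma num_branch_active_eq: "num_branch_active G = card active"
proof -
  have "{v. branch_active G v} = c ` active"
    by (auto simp: active_def branch_active_iff)
  moreover have "inj_on c active" using inj_c by (auto simp: active_def inj_on_def)
  ultimately show ?thesis by (simp add: num_branch_active_def card_image)
qed

lemma fork_active:
  assumes "v \<in> forks" "u \<in> thread_heads v" shows "idx u \<in> active"
proof -
  have u: "u \<in> children v" using assms thread_heads_children by blast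
  then have v: "v \<in> V" "idx u = idx v" using children_D[OF u] idx_par[of u] by auto
  have "card (children v) \<ge> 2"
    using assms card_mono[OF finite_children thread_heads_children, of v] by (simp add: forks_def)
  then show ?thesis using v desc_idx[of v] idx_less[of v]
    by (auto simp: active_def branch_active_iff)
qed

text \<open>The heads of two threads with a common vertex are comparable. Were one strictly below
  the other, its parent would be a fork inside a pathlike subtree.\<close>

lemma fork_threads_disjoint:
  assumes "v \<in> forks" "u \<in> thread_heads v" "v' \<in> forks" "u' \<in> thread_heads v'"
    "x \<in> desc u" "x \<in> desc u'"
  shows "u = u'"
proof -
  have *: "u = u'" if "v \<in> forks" "u \<in> thread_heads v" "u' \<in> thread_heads v'" "u \<in> desc u'" for u v u' v'
  proof (rule ccontr)
    assume "u \<noteq> u'"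
    with that(4) have "par u \<in> desc u'" by (cases rule: desc_cases) auto
    moreover have "par u = v" using that thread_heads_children children_D by blast
    ultimately have "card (children v) \<le> 1"
      using that(3) by (auto simp: thread_heads_def pathlike_def)
    then show False
      using that(1) card_mono[OF finite_children thread_heads_children, of v] by (simp add: forks_def)
  qed
  show ?thesis
    using desc_linear[OF assms(5,6)] *[of v u u' v'] *[of v' u' u v] assms by blast
qed

lemma finite_forks: "finite forks"
  using finite_V by (simp add: forks_def)

text \<open>Distinct threads need distinct landmarks, and these lie in branch-active trees. If there
  are fewer than two such trees, \<open>biactive\<close> forces further landmarks.\<close>

lemma card_lower_bound:
  assumes "hits_threads S" "biactive S"
  shows "thread_sum G + (2 - num_branch_active G) \<le> card S"
proof -
  have S: "S \<subseteq> V" "finite S" using assms finite_subset finite_V by (auto simp: hits_threads_def)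
  define hit where "hit v = {u \<in> thread_heads v. S \<inter> desc u \<noteq> {}}" for v
  define H where "H = (\<Union>v\<in>forks. hit v)"
  have fin: "finite (hit v)" for v using finite_thread_heads by (simp add: hit_def)
  have "card (thread_heads v) - 1 \<le> card (hit v)" for v
  proof -
    have "card (thread_heads v - hit v) \<le> 1"
      using assms(1) finite_thread_heads[of v] unfolding card_le_Suc0_iff_eq[of "thread_heads v - hit v"] One_nat_def
      by (auto simp: card_le_Suc0_iff_eq hits_threads_def hit_def)
    then show ?thesis using fin[of v] card_Diff_subset[of "hit v" "thread_heads v"]
      by (auto simp: hit_def)
  qed
  then have "thread_sum G \<le> (\<Sum>v\<in>forks. card (hit v))"
    by (simp add: thread_sum_eq sum_mono)
  also have "\<dots> = card H"
    unfolding H_def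
    by (rule card_UN_disjoint[symmetric])
      (use finite_forks fin children_D thread_heads_children in \<open>auto simp: hit_def, blast\<close>)
  finally have H: "thread_sum G \<le> card H" .
  have "\<forall>u\<in>H. \<exists>s. s \<in> S \<inter> desc u" by (auto simp: H_def hit_def)
  \<comment> \<open>\<open>g\<close> chooses a landmark in each met thread; it is injective because
    the threads are disjoint.\<close>
  then obtain g where g: "\<And>u. u \<in> H \<Longrightarrow> g u \<in> S \<and> g u \<in> desc u" by (metis IntE)
  have "inj_on g H"
  proof (rule inj_onI)
    fix u w assume "u \<in> H" "w \<in> H" "g u = g w"
    then show "u = w" using g[of u] g[of w] fork_threads_disjoint by (auto simp: H_def hit_def)
  qed
  then have gH: "card (g ` H) = card H" "g ` H \<subseteq> S" using g by (auto simp: card_image)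
  have idx_g: "idx s \<in> active" if "s \<in> g ` H" for s
    using that g idx_desc fork_active by (fastforce simp: H_def hit_def)
  have fin_A: "finite active" by (simp add: active_def)
  consider "card active \<ge> 2" | "card active = 1" | "card active = 0" by linarith
  then have "card H + (2 - card active) \<le> card S"
  proof cases
    case 1
    then show ?thesis using gH S card_mono[of S "g ` H"] by simp
  next
    case 2
    then obtain i where i: "active = {i}" by (auto simp: card_1_singleton_iff)
    then have "i < n" by (auto simp: active_def)
    \<comment> \<open>All chosen landmarks lie in the single active tree, so one outside that tree
      is additional.\<close>
    with assms(2) obtain s where s: "s \<in> S" "idx s \<noteq> i" by (auto simp: biactive_def)
    then have "s \<notin> g ` H" using idx_g i by blast
    then have "card (insert s (g ` H)) = Suc (card H)"
      using gH S finite_subset by (metis card_insert_disjoint)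
    moreover have "insert s (g ` H) \<subseteq> S" using s gH by simp
    ultimately have "Suc (card H) \<le> card S" using S card_mono by metis
    then show ?thesis using 2 by simp
  next
    case 3
    then have "active = {}" using fin_A by simp
    \<comment> \<open>Without active trees there is no thread to count, and two landmarks in
      different trees remain.\<close>
    then have "g ` H = {}" using idx_g by blast
    moreover have "0 < n" using n_ge_3 by simp
    then obtain s where s: "s \<in> S" using assms(2) unfolding biactive_def by blast
    moreover obtain t where t: "t \<in> S" "idx t \<noteq> idx s"
      using assms(2) idx_less[OF subsetD[OF S(1) s]] unfolding biactive_def by blast
    moreover have "card {s, t} \<le> card S" using S(2) s t(1) by (auto intro!: card_mono)
    moreover have "s \<noteq> t" using t(2) by blast
    then have "card {s, t} = 2" by simp
    ultimately have "card {s, t} \<le> card S" "card {s, t} = 2" "H = {}"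
      by auto
    then show ?thesis by simp
  qed
  then show ?thesis using H by (simp add: num_branch_active_eq)
qed

section \<open>Separating vertices of equal height in one tree\<close>

lemma ex_fork:
  assumes "x \<in> desc r" "card (children x) \<ge> 2" obtains y where "y \<in> desc r" "y \<in> forks"
proof -
  \<comment> \<open>A member of \<open>X\<close> of greatest height has no branching vertex below
    it, so all its children start threads.\<close>
  define X where "X = {y \<in> desc r. card (children y) \<ge> 2}"
  have "finite X" "X \<noteq> {}" using finite_desc assms by (auto simp: X_def)
  then have "Max (h ` X) \<in> h ` X" by (intro Max_in) auto
  then obtain y where y: "y \<in> X" "h y = Max (h ` X)" by auto
  have max: "h z \<le> h y" if "z \<in> X" for z
    unfolding y(2) using \<open>finite X\<close> that by (intro Max_ge) auto
  have "pathlike u" if u: "u \<in> children y" for u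
    unfolding pathlike_def
  proof
    fix z assume z: "z \<in> desc u"
    then have "z \<in> desc r" using desc_trans child_in_desc[OF u] y by (auto simp: X_def)
    moreover have "h y < h z" using children_D[OF u] h_desc_le[OF z] by simp
    ultimately show "card (children z) \<le> 1" using max[of z] by (force simp: X_def)
  qed
  then have "thread_heads y = children y" by (auto simp: thread_heads_def)
  then have "y \<in> forks" using y desc_verts by (auto simp: X_def forks_def)
  with y that show ?thesis by (auto simp: X_def)
qed

lemma thread_heads_desc: "y \<in> desc r \<Longrightarrow> u \<in> thread_heads y \<Longrightarrow> u \<in> desc r"
  using thread_heads_children child_in_desc desc_trans by blast

lemma fork_two_heads:
  assumes "y \<in> forks" obtains u w where "u \<in> thread_heads y" "w \<in> thread_heads y" "u \<noteq> w"
  using assms finite_thread_heads[of y] card_le_Suc0_iff_eq[of "thread_heads y"]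
  by (auto simp: forks_def)

text \<open>A subtree that is not a path contains a fork, and of two threads there one is met. Two
  sibling paths are themselves threads at \<open>m\<close>.\<close>

lemma siblings_hit:
  assumes "hits_threads S" "a \<in> children m" "b \<in> children m" "a \<noteq> b"
  shows "S \<inter> desc a \<noteq> {} \<or> S \<inter> desc b \<noteq> {}"
proof -
  have *: "S \<inter> desc a \<noteq> {}" if "\<not> pathlike a" for a
  proof -
    from that obtain x where "x \<in> desc a" "card (children x) \<ge> 2" by (auto simp: pathlike_def)
    then obtain y where y: "y \<in> desc a" "y \<in> forks" using ex_fork by blast
    then obtain u w where "u \<in> thread_heads y" "w \<in> thread_heads y" "u \<noteq> w"
      using fork_two_heads by blast
    with assms(1) y have "u \<in> desc a" "w \<in> desc a" "S \<inter> desc u \<noteq> {} \<or> S \<inter> desc w \<noteq> {}"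
      using thread_heads_desc by (auto simp: hits_threads_def)
    then show ?thesis using desc_trans by blast
  qed
  show ?thesis
  proof (cases "pathlike a \<and> pathlike b")
    case True
    with assms have "a \<in> thread_heads m" "b \<in> thread_heads m" by (auto simp: thread_heads_def)
    with assms show ?thesis by (auto simp: hits_threads_def)
  qed (use * in blast)
qed

text \<open>Climb from \<open>x\<close> and \<open>y\<close> in parallel until the parents agree.
  This happens at the latest on the cycle, where equal indices give a common root.\<close>

lemma ex_siblings:
  "x \<in> V \<Longrightarrow> y \<in> V \<Longrightarrow> x \<noteq> y \<Longrightarrow> h x = h y \<Longrightarrow> idx x = idx y \<Longrightarrow>
    \<exists>m a b. a \<in> children m \<and> b \<in> children m \<and> a \<noteq> b \<and> x \<in> desc a \<and> y \<in> desc b"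
proof (induction "h x" arbitrary: x y)
  case 0
  then have "x \<in> C" "y \<in> C" using h_eq_0 by metis+
  then show ?case using 0 idx_c by auto
next
  case (Suc k)
  then have C: "x \<notin> C" "y \<notin> C" using h_C by (metis nat.distinct(1))+
  then have ch: "x \<in> children (par x)" "y \<in> children (par y)" using children_I Suc.prems by auto
  show ?case
  proof (cases "par x = par y")
    case True
    then show ?thesis using ch Suc.prems desc_refl by metis
  next
    case False
    have "k = h (par x)" "h (par x) = h (par y)"
      using h_par C Suc.prems Suc.hyps(2) by (metis nat.inject)+
    from Suc.hyps(1)[OF this(1) _ _ False this(2)] show ?thesis
      using Suc.prems par_verts idx_par desc_par by metis
  qed
qed

text \<open>The way from \<open>y\<close> to \<open>s\<close> climbs through \<open>b\<close> to
  \<open>m\<close> before it enters the subtree of \<open>a\<close>, whereas \<open>x\<close> and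
  \<open>s\<close> are joined through \<open>a\<close>. The gap of 2 and \<open>s\<close> \<notin>
  \<open>desc y\<close> prepare the case of edges: passing from \<open>y\<close> to its parent edge
  costs 1 and leaves a strict inequality.\<close>

lemma sibling_distance:
  assumes ab: "a \<in> children m" "b \<in> children m" "a \<noteq> b"
    and xy: "x \<in> desc a" "y \<in> desc b" "h x = h y" and s: "s \<in> desc a"
  shows "d x s + 2 \<le> d y s \<and> s \<notin> desc y"
proof -
  have V: "x \<in> V" "y \<in> V" "s \<in> V" "a \<in> V" "b \<in> V" "m \<in> V"
    using desc_verts ab xy s children_D by blast+
  have h: "h a = Suc (h m)" "h b = Suc (h m)" using ab children_D by auto
  have disj: False if "z \<in> desc a" "z \<in> desc b" for z
    using desc_linear[OF that] desc_antisym[of a b] desc_antisym[of b a] h ab by auto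
  have "a \<notin> desc b" using disj desc_refl V by blast
  have "y \<notin> desc a" using disj xy by blast
  have "d s y + h a = h s + d a y" using distance_desc[OF s, of y] V \<open>y \<notin> desc a\<close> by blast
  moreover have "d y a + h b = h y + d b a" using distance_desc[OF xy(2), of a] V \<open>a \<notin> desc b\<close> by blast
  moreover have "d b a = Suc (d m a)"
    using distance_par[of b a] children_D[OF ab(2)] V \<open>a \<notin> desc b\<close> by auto
  moreover have "m \<noteq> a" using h by auto
  then have "d m a > 0" using distance_eq_0 V by auto
  moreover have "d x s \<le> d x a + d a s" using distance_triangle V by blast
  moreover have "d x a + h a \<le> h x" "d s a + h a \<le> h s" using distance_pow_par_le V xy(1) s by blast+
  ultimately have "d x s + 2 \<le> d y s"
    using distance_sym[of s y] distance_sym[of a s] distance_sym[of y a] V h xy(3) by simp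
  moreover have "s \<notin> desc y" using disj[of s] s xy desc_trans by blast
  ultimately show ?thesis by blast
qed

lemma separated_in_tree:
  assumes "hits_threads S" "x \<in> V" "y \<in> V" "x \<noteq> y" "h x = h y" "idx x = idx y"
  obtains s where "s \<in> S" "d x s + 2 \<le> d y s \<and> s \<notin> desc y \<or> d y s + 2 \<le> d x s \<and> s \<notin> desc x"
proof -
  obtain m a b where *: "a \<in> children m" "b \<in> children m" "a \<noteq> b" "x \<in> desc a" "y \<in> desc b"
    using ex_siblings assms by blast
  then have "S \<inter> desc a \<noteq> {} \<or> S \<inter> desc b \<noteq> {}" using siblings_hit assms(1) by blast
  then show ?thesis
  proof
    assume "S \<inter> desc a \<noteq> {}"
    then show ?thesis using that sibling_distance[OF *(1,2,3,4,5) assms(5)] by blast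
  next
    assume "S \<inter> desc b \<noteq> {}"
    then show ?thesis
      using that sibling_distance[OF *(2,1) *(3)[symmetric] *(5,4) assms(5)[symmetric]] by blast
  qed
qed

section \<open>Reading position and height from a geodesic triple\<close>

text \<open>Distances are doubled so that the midpoint of the cycle edge from \<^term>\<open>c i\<close> gets the
  integer position \<open>2 * i + 1\<close> on a cycle of length \<open>2 * n\<close>; edges are measured from their
  midpoints, hence the \<open>+ 1\<close> in their profiles.\<close>

definition "profile D p H \<longleftrightarrow> 0 \<le> p \<and> p < 2 * int n \<and>
  (\<forall>s\<in>V. D s \<le> H + cdist (2 * int n) p (2 * int (idx s)) + 2 * int (h s) \<and>
    (p \<noteq> 2 * int (idx s) \<longrightarrow> D s = H + cdist (2 * int n) p (2 * int (idx s)) + 2 * int (h s)))"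

lemma cdist_double: "cdist (2 * m) (2 * i) (2 * j) = 2 * cdist m i j"
  by (simp add: cdist_def min_def abs_if)

lemma geodesic_triple_double: "geodesic_triple m i j k \<Longrightarrow> geodesic_triple (2 * m) (2 * i) (2 * j) (2 * k)"
  by (auto simp: geodesic_triple_def cdist_double)

text \<open>The triple determines the position, with the difference of the two constants as offset.
  The constant is then read off at a landmark whose tree has another position, where the formula is
  exact.\<close>

lemma profile_eq:
  assumes "geodesic_triple (int n) (int (idx s1)) (int (idx s2)) (int (idx s3))" "{s1, s2, s3} \<subseteq> V"
    and D: "profile D p H" and D': "profile D' p' H'" and eq: "\<And>s. s \<in> {s1, s2, s3} \<Longrightarrow> D s = D' s"
  shows "p = p' \<and> H = H'"
proof -
  note triple = geodesic_triple_double[OF assms(1)]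
  have p: "p = p'"
  proof (rule geodesic_triple_resolves[OF triple, where k = "H - H'"])
    fix t assume "t \<in> {2 * int (idx s1), 2 * int (idx s2), 2 * int (idx s3)}"
    then obtain s where s: "s \<in> {s1, s2, s3}" "t = 2 * int (idx s)" by auto
    then have sV: "s \<in> V" and eq_s: "D s = D' s" using assms(2) eq by blast+
    show "H - H' + cdist (2 * int n) p t \<le> cdist (2 * int n) p' t" if "t \<noteq> p"
      using that D D' s(2) sV eq_s unfolding profile_def by force
    show "cdist (2 * int n) p' t \<le> H - H' + cdist (2 * int n) p t" if "t \<noteq> p'"
      using that D D' s(2) sV eq_s unfolding profile_def by force
  qed (use D D' in \<open>auto simp: profile_def\<close>)
  moreover have "H = H'"
  proof -
    have "2 * int (idx s1) \<noteq> p \<or> 2 * int (idx s2) \<noteq> p"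
      using triple by (auto simp: geodesic_triple_def)
    then obtain s where s: "s \<in> {s1, s2, s3}" "2 * int (idx s) \<noteq> p" by blast
    then have sV: "s \<in> V" and eq_s: "D s = D' s" using assms(2) eq by blast+
    then show ?thesis using s D D' p unfolding profile_def by force
  qed
  ultimately show ?thesis ..
qed

lemma vertex_profile:
  assumes "x \<in> V" shows "profile (\<lambda>s. 2 * int (d x s)) (2 * int (idx x)) (2 * int (h x))"
  using distance_le_idx[OF assms] distance_idx[OF assms] idx_less[OF assms]
  unfolding profile_def cdist_double by force

text \<open>The constant is twice the height \<open>h x - 1/2\<close> of the midpoint.\<close>

lemma tree_edge_profile:
  assumes "x \<in> V" "x \<notin> C"
  shows "profile (\<lambda>s. 2 * int (edge_distance G {x, par x} s) + 1) (2 * int (idx x)) (2 * int (h x) - 1)"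
proof -
  have h: "h x = Suc (h (par x))" and i: "idx (par x) = idx x" "par x \<in> V"
    using h_par assms idx_par par_verts by auto
  show ?thesis
    unfolding profile_def cdist_double edge_distance_doubleton
  proof (intro conjI ballI impI)
    fix s assume s: "s \<in> V"
    note le = distance_le_idx[OF i(2) s, unfolded i(1)]
    show "2 * int (min (d x s) (d (par x) s)) + 1
      \<le> 2 * int (h x) - 1 + 2 * cdist (int n) (int (idx x)) (int (idx s)) + 2 * int (h s)"
      using le h by simp
    assume "2 * int (idx x) \<noteq> 2 * int (idx s)"
    then have "idx x \<noteq> idx s" by simp
    then show "2 * int (min (d x s) (d (par x) s)) + 1
      = 2 * int (h x) - 1 + 2 * cdist (int n) (int (idx x)) (int (idx s)) + 2 * int (h s)"
      using distance_idx[OF i(2) s] distance_idx[OF assms(1) s] i h by simp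
  qed (use idx_less assms in auto)
qed

text \<open>The midpoint is reached through the nearer end of the edge and half an edge more, which
  counts 1 after doubling.\<close>

lemma cdist_midpoint:
  assumes "i < n" "t < n"
  shows "2 * min (cdist (int n) (int i) (int t)) (cdist (int n) (int (Suc i mod n)) (int t)) + 1
    = cdist (2 * int n) (2 * int i + 1) (2 * int t)"
proof (cases "Suc i = n")
  case True
  then show ?thesis using assms by (auto simp: cdist_def min_def abs_if)
next
  case False
  then show ?thesis using assms by (auto simp: cdist_def min_def abs_if)
qed

lemma cycle_edge_profile:
  assumes "i < n"
  shows "profile (\<lambda>s. 2 * int (edge_distance G {c i, c (Suc i mod n)} s) + 1) (2 * int i + 1) 0"
proof -
  have j: "Suc i mod n < n" using n_ge_3 by simp
  have "2 * int (min (d (c i) s) (d (c (Suc i mod n)) s)) + 1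
      = cdist (2 * int n) (2 * int i + 1) (2 * int (idx s)) + 2 * int (h s)" if "s \<in> V" for s
    using distance_c_vertex[OF assms that] distance_c_vertex[OF j that]
      cdist_midpoint[OF assms idx_less[OF that]] by (simp add: of_nat_min min_add_distrib_left[symmetric] min_def split: if_splits)
  then show ?thesis using assms by (auto simp: profile_def edge_distance_doubleton)
qed

lemma edge_cases:
  assumes "e \<in> edges G"
  obtains x where "x \<in> V" "x \<notin> C" "e = {x, par x}" | i where "i < n" "e = {c i, c (Suc i mod n)}"
proof -
  obtain u v where e: "e = {u, v}" "adj G u v" using edge_adj assms by blast
  from adj_cases[OF e(2)] show ?thesis
    using that adj_verts[OF e(2)] e(1) by (elim disjE exE conjE) (auto simp: insert_commute)
qed

section \<open>Sufficient conditions and a small generator\<close>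

context
  fixes S s1 s2 s3
  assumes hits: "hits_threads S" and triple_S: "{s1, s2, s3} \<subseteq> S"
    and triple: "geodesic_triple (int n) (int (idx s1)) (int (idx s2)) (int (idx s3))"
begin

lemma S_verts: "S \<subseteq> V" "{s1, s2, s3} \<subseteq> V"
  using hits triple_S by (auto simp: hits_threads_def)

text \<open>The triple fixes tree and height, and \<open>separated_in_tree\<close> does the
  rest.\<close>

lemma vertex_generator: "vertex_metric_generator G S"
  unfolding vertex_metric_generator_def
proof (intro conjI S_verts ballI impI)
  fix x y assume xy: "x \<in> V" "y \<in> V" "x \<noteq> y"
  show "\<exists>s\<in>S. d x s \<noteq> d y s"
  proof (rule ccontr)
    assume "\<not> ?thesis"
    then have eq: "d x s = d y s" if "s \<in> S" for s using that by blast
    then have "2 * int (idx x) = 2 * int (idx y) \<and> 2 * int (h x) = 2 * int (h y)"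
      by (intro profile_eq[OF triple S_verts(2) vertex_profile vertex_profile]) (use xy triple_S in auto)
    then obtain s where "s \<in> S" "d x s + 2 \<le> d y s \<or> d y s + 2 \<le> d x s"
      using separated_in_tree[OF hits xy] by auto
    with eq show False by force
  qed
qed

text \<open>Tree edges have even positions and cycle edges odd ones. A cycle edge is determined by
  its position; tree edges are separated through their outer ends.\<close>

lemma edge_generator: "edge_metric_generator G S"
  unfolding edge_metric_generator_def
proof (intro conjI S_verts ballI impI)
  fix e f assume ef: "e \<in> edges G" "f \<in> edges G" "e \<noteq> f"
  show "\<exists>s\<in>S. edge_distance G e s \<noteq> edge_distance G f s"
  proof (rule ccontr)
    assume "\<not> ?thesis"
    then have eq: "edge_distance G e s = edge_distance G f s" if "s \<in> S" for s using that by blast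
    have prof: "p = q \<and> H = K" if "profile (\<lambda>s. 2 * int (edge_distance G e s) + 1) p H"
      "profile (\<lambda>s. 2 * int (edge_distance G f s) + 1) q K" for p q H K
      by (rule profile_eq[OF triple S_verts(2) that]) (use eq triple_S in auto)
    from ef(1) show False
    proof (cases rule: edge_cases)
      case e: (1 x)
      from ef(2) show False
      proof (cases rule: edge_cases)
        case f: (1 y)
        have "idx x = idx y" "h x = h y"
          using prof tree_edge_profile[OF e(1,2)] tree_edge_profile[OF f(1,2)] e(3) f(3) by force+
        moreover have "x \<noteq> y" using ef e f by auto
        ultimately obtain s where s: "s \<in> S"
          "d x s + 2 \<le> d y s \<and> s \<notin> desc y \<or> d y s + 2 \<le> d x s \<and> s \<notin> desc x"
          using separated_in_tree[OF hits e(1) f(1)] by auto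
        then have "s \<in> V" using S_verts by blast
        \<comment> \<open>For \<open>s\<close> outside \<open>desc y\<close>, the nearer end of the
          edge below \<open>par y\<close> is \<open>par y\<close>, at distance
          \<open>d y s - 1\<close>, which still exceeds \<open>d x s\<close>. The other case is
          symmetric.\<close>
        then have "min (d x s) (d (par x) s) \<noteq> min (d y s) (d (par y) s)"
          using s(2) distance_par[OF e(1,2)] distance_par[OF f(1,2)] by auto
        then show False using eq[OF s(1)] e f by (simp add: edge_distance_doubleton)
      next
        case f: (2 j)
        have "2 * int (idx x) = 2 * int j + 1"
          using prof tree_edge_profile[OF e(1,2)] cycle_edge_profile[OF f(1)] e(3) f(2) by metis
        then show False by presburger
      qed
    next
      case e: (2 i)
      from ef(2) show False
      proof (cases rule: edge_cases)
        case f: (1 y)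
        have "2 * int i + 1 = 2 * int (idx y)"
          using prof tree_edge_profile[OF f(1,2)] cycle_edge_profile[OF e(1)] e(2) f(3) by metis
        then show False by presburger
      next
        case f: (2 j)
        have "2 * int i + 1 = 2 * int j + 1"
          using prof cycle_edge_profile[OF e(1)] cycle_edge_profile[OF f(1)] e(2) f(2) by metis
        then show False using ef e f by simp
      qed
    qed
  qed
qed

end

text \<open>One set serves both dimensions, so a single count bounds both.\<close>

lemma ex_small_generator:
  obtains S where "card S \<le> thread_sum G + (2 - num_branch_active G) + 1"
    "vertex_metric_generator G S" "edge_metric_generator G S"
proof -
  \<comment> \<open>The one thread at a fork \<open>v\<close> whose head is left out.\<close>
  define pick where "pick v = (SOME u. u \<in> thread_heads v)" for v
  have pick: "pick v \<in> thread_heads v" if "v \<in> forks" for v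
    using fork_two_heads[OF that] someI unfolding pick_def by metis
  define S0 where "S0 = (\<Union>v\<in>forks. thread_heads v - {pick v})"
  have "card S0 = (\<Sum>v\<in>forks. card (thread_heads v - {pick v}))"
    unfolding S0_def
    by (rule card_UN_disjoint)
      (use finite_forks finite_thread_heads children_D thread_heads_children in \<open>auto, blast\<close>)
  also have "\<dots> = thread_sum G"
    unfolding thread_sum_eq using pick finite_thread_heads by (intro sum.cong) auto
  finally have card_S0: "card S0 = thread_sum G" .
  have S0: "S0 \<subseteq> V" "finite S0" using thread_heads_children children_D finite_V finite_subset
    by (auto simp: S0_def finite_forks finite_thread_heads)
  \<comment> \<open>An active tree contains a fork, which has a thread head other than the picked
    one.\<close>
  have act: "\<exists>s\<in>S0. idx s = i" if "i \<in> active" for i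
  proof -
    from that obtain x where i: "i < n" and "x \<in> desc (c i)" "card (children x) \<ge> 2"
      by (auto simp: active_def branch_active_iff)
    then obtain y where y: "y \<in> desc (c i)" "y \<in> forks" using ex_fork by blast
    then obtain u where u: "u \<in> thread_heads y" "u \<noteq> pick y" using fork_two_heads by metis
    have "idx u = i" using idx_eq[OF thread_heads_desc[OF y(1) u(1)] i] .
    with u y show ?thesis by (auto simp: S0_def)
  qed
  have fin_A: "finite active" "active \<subseteq> {..<n}" by (auto simp: active_def)
  \<comment> \<open>\<open>I\<close> supplies cycle positions for the trees still missing;
    \<open>i\<close> and \<open>j\<close> number two trees that are then met.\<close>
  obtain I i j where I: "I \<subseteq> {..<n}" "finite I" "card I \<le> 2 - card active" "i \<in> active \<union> I" "j \<in> active \<union> I" "i \<noteq> j"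
  proof -
    consider "card active \<ge> 2" | "card active = 1" | "card active = 0" by linarith
    then show ?thesis
    proof cases
      case 1
      then obtain i j where "i \<in> active" "j \<in> active" "i \<noteq> j"
        using card_le_Suc0_iff_eq[OF fin_A(1)] by force
      then show ?thesis using that[of "{}" i j] by simp
    next
      case 2
      then obtain i where "active = {i}" by (auto simp: card_1_singleton_iff)
      then show ?thesis using that[of "{if i = 0 then 1 else 0}" i "if i = 0 then 1 else 0"] n_ge_3
        by auto
    next
      case 3
      then show ?thesis using that[of "{0, 1}" 0 1] n_ge_3 by auto
    qed
  qed
  have ij: "i < n" "j < n" using I fin_A by auto
  with I(6) n_ge_3 obtain k where "geodesic_triple (int n) (int i) (int j) k"
    using geodesic_triple_exists[of "int n" "int i" "int j"] by auto
  moreover from this have "k = int (nat k)" "nat k < n" by (auto simp: geodesic_triple_def)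
  ultimately obtain k where k: "geodesic_triple (int n) (int i) (int j) (int k)" "k < n" by metis
  define S where "S = S0 \<union> c ` I \<union> {c k}"
  have "card S \<le> card S0 + card (c ` I) + card {c k}"
    unfolding S_def by (intro order_trans[OF card_Un_le] add_mono) auto
  also have "\<dots> \<le> thread_sum G + (2 - num_branch_active G) + 1"
    using card_image_le[OF I(2), of c] I(3) card_S0 by (simp add: num_branch_active_eq)
  finally have card_S: "card S \<le> thread_sum G + (2 - num_branch_active G) + 1" .
  have ex: "\<exists>s\<in>S. idx s = t" if "t \<in> active \<union> I" for t
    using that act I(1) idx_c by (force simp: S_def)
  obtain s1 s2 where s: "s1 \<in> S" "s2 \<in> S" "idx s1 = i" "idx s2 = j" using ex I by metis
  have hits: "hits_threads S"
    unfolding hits_threads_def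
  proof (intro conjI allI ballI impI)
    show "S \<subseteq> V" using S0 I(1) k c_verts by (auto simp: S_def)
    fix v u w assume u: "u \<in> thread_heads v" "w \<in> thread_heads v" "u \<noteq> w"
    then have V: "u \<in> V" "w \<in> V" "v \<in> V" using thread_heads_children children_D by blast+
    have "v \<in> forks" using u V card_le_Suc0_iff_eq[OF finite_thread_heads, of v]
      by (force simp: forks_def)
    then have "u \<in> S \<or> w \<in> S" using u by (auto simp: S_def S0_def)
    then show "S \<inter> desc u \<noteq> {} \<or> S \<inter> desc w \<noteq> {}" using desc_refl V by blast
  qed
  have "geodesic_triple (int n) (int (idx s1)) (int (idx s2)) (int (idx (c k)))" "{s1, s2, c k} \<subseteq> S"
    using s k idx_c by (auto simp: S_def)
  with that[OF card_S] vertex_generator[OF hits] edge_generator[OF hits] show ?thesis by blast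
qed

lemma metric_dim_bounds:
  "thread_sum G + (2 - num_branch_active G) \<le> metric_dim G"
  "metric_dim G \<le> thread_sum G + (2 - num_branch_active G) + 1"
proof -
  obtain S where S: "card S \<le> thread_sum G + (2 - num_branch_active G) + 1" "vertex_metric_generator G S"
    using ex_small_generator by blast
  then have *: "\<exists>S'. vertex_metric_generator G S' \<and> card S' = card S" by blast
  from LeastI[of "\<lambda>k. \<exists>S. vertex_metric_generator G S \<and> card S = k", OF *]
  obtain S' where "vertex_metric_generator G S'" "card S' = metric_dim G"
    by (auto simp: metric_dim_def)
  then show "thread_sum G + (2 - num_branch_active G) \<le> metric_dim G"
    using card_lower_bound vertex_generator_hits by metis
  show "metric_dim G \<le> thread_sum G + (2 - num_branch_active G) + 1"
    using Least_le[of "\<lambda>k. \<exists>S. vertex_metric_generator G S \<and> card S = k", OF *] S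
    by (simp add: metric_dim_def)
qed

lemma edge_metric_dim_bounds:
  "thread_sum G + (2 - num_branch_active G) \<le> edge_metric_dim G"
  "edge_metric_dim G \<le> thread_sum G + (2 - num_branch_active G) + 1"
proof -
  obtain S where S: "card S \<le> thread_sum G + (2 - num_branch_active G) + 1" "edge_metric_generator G S"
    using ex_small_generator by blast
  then have *: "\<exists>S'. edge_metric_generator G S' \<and> card S' = card S" by blast
  from LeastI[of "\<lambda>k. \<exists>S. edge_metric_generator G S \<and> card S = k", OF *]
  obtain S' where "edge_metric_generator G S'" "card S' = edge_metric_dim G"
    by (auto simp: edge_metric_dim_def)
  then show "thread_sum G + (2 - num_branch_active G) \<le> edge_metric_dim G"
    using card_lower_bound edge_generator_hits by metis
  show "edge_metric_dim G \<le> thread_sum G + (2 - num_branch_active G) + 1"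
    using Least_le[of "\<lambda>k. \<exists>S. edge_metric_generator G S \<and> card S = k", OF *] S
    by (simp add: edge_metric_dim_def)
qed

end

section \<open>The structure of unicyclic graphs\<close>

text \<open>Uniqueness is recorded for vertex sets: the second cycles constructed below differ from
  \<open>xs\<close> already in their vertices.\<close>

locale unicyclic_graph = conn_graph +
  fixes xs :: "'a list"
  assumes len: "length xs \<ge> 3" and path_xs: "path G xs" and closed: "adj G (last xs) (hd xs)"
    and only_cycle: "length ys \<ge> 3 \<Longrightarrow> path G ys \<Longrightarrow> adj G (last ys) (hd ys) \<Longrightarrow> set ys = set xs"
begin

section \<open>Heights and parents\<close>

definition "height x = Min (d x ` set xs)"
definition "step_avoiding v x y \<longleftrightarrow> adj G x y \<and> x \<noteq> v \<and> y \<noteq> v"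
text \<open>Off the cycle the choice turns out to be forced, by
  \<open>lower_neighbour_unique\<close>.\<close>

definition "parent x = (if x \<in> set xs then x else SOME y. adj G x y \<and> height x = Suc (height y))"

lemma xs_verts: "set xs \<subseteq> V" and distinct_xs: "distinct xs"
  using path_xs by (auto simp: path_def walk_def)

lemma height_le: "z \<in> set xs \<Longrightarrow> height x \<le> d x z"
  by (simp add: height_def)

lemma ex_height: obtains z where "z \<in> set xs" "height x = d x z"
proof -
  have "set xs \<noteq> {}" using len by auto
  then have "height x \<in> d x ` set xs" unfolding height_def by (intro Min_in) auto
  with that show ?thesis by auto
qed

lemma height_adj_le: assumes "adj G x y" shows "height x \<le> Suc (height y)"
proof -
  obtain z where z: "z \<in> set xs" "height y = d y z" by (rule ex_height)
  then have "d x z \<le> Suc (d y z)" using distance_adj_le assms xs_verts by blast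
  with z height_le[of z x] show ?thesis by simp
qed

lemma height_eq_0: assumes "x \<in> V" shows "height x = 0 \<longleftrightarrow> x \<in> set xs"
proof
  assume "height x = 0"
  moreover obtain z where "z \<in> set xs" "height x = d x z" by (rule ex_height)
  ultimately show "x \<in> set xs" using distance_eq_0[OF assms] xs_verts by auto
qed (use height_le[of x x] assms in auto)

lemma ex_parent:
  assumes "x \<in> V" "x \<notin> set xs" obtains y where "adj G x y" "height x = Suc (height y)"
proof -
  obtain z where z: "z \<in> set xs" "height x = d x z" by (rule ex_height)
  then have "z \<in> V" "x \<noteq> z" using assms xs_verts by auto
  then obtain y where y: "adj G x y" "d x z = Suc (d y z)" using distance_step assms by blast
  then have "height x = Suc (height y)"
    using z height_le[OF z(1), of y] height_adj_le[OF y(1)] by simp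
  with y that show ?thesis by blast
qed

lemma parent:
  assumes "x \<in> V" "x \<notin> set xs" shows "adj G x (parent x) \<and> height x = Suc (height (parent x))"
proof -
  have "\<exists>y. adj G x y \<and> height x = Suc (height y)" using ex_parent[OF assms] by blast
  from someI_ex[OF this] show ?thesis using assms(2) by (simp add: parent_def)
qed

section \<open>Connections that avoid a given vertex\<close>

lemma step_avoiding_sym: "(step_avoiding v)\<^sup>*\<^sup>* x y \<Longrightarrow> (step_avoiding v)\<^sup>*\<^sup>* y x"
proof (induction rule: rtranclp_induct)
  case (step y z)
  then have "step_avoiding v z y" by (auto simp: step_avoiding_def adj_sym)
  then show ?case using step.IH by (rule converse_rtranclp_into_rtranclp)
qed simp

text \<open>The path grows step by step; when a step returns to a visited vertex, the path is cut
  back to that vertex.\<close>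

lemma step_avoiding_path:
  "(step_avoiding v)\<^sup>*\<^sup>* x y \<Longrightarrow> x \<in> V \<Longrightarrow> x \<noteq> v \<Longrightarrow>
    \<exists>ys. path G ys \<and> hd ys = x \<and> last ys = y \<and> v \<notin> set ys"
proof (induction rule: rtranclp_induct)
  case base
  then have "path G [x]" "v \<notin> set [x]" by (auto simp: path_def walk_def)
  then show ?case by (metis last.simps list.sel(1))
next
  case (step y z)
  then obtain ys where ys: "path G ys" "hd ys = x" "last ys = y" "v \<notin> set ys" by blast
  then have "ys \<noteq> []" by (auto simp: path_def walk_def)
  show ?case
  proof (cases "z \<in> set ys")
    case True
    then obtain as bs where "ys = as @ z # bs" by (meson split_list)
    with ys have "path G (as @ [z])" "hd (as @ [z]) = x" "v \<notin> set (as @ [z])"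
      by (auto simp: path_def walk_def successively_append_iff hd_append)
    then show ?thesis by (metis last_snoc)
  next
    case False
    with ys \<open>ys \<noteq> []\<close> step.hyps(2) have "path G (ys @ [z])" "hd (ys @ [z]) = x" "v \<notin> set (ys @ [z])"
      using adj_verts by (auto simp: path_def walk_def successively_append_iff step_avoiding_def)
    then show ?thesis by (metis last_snoc)
  qed
qed

text \<open>After the first step down the height is below that of \<open>v\<close>, so the descent
  cannot meet \<open>v\<close>.\<close>

lemma descend_to_cycle:
  "x \<in> V \<Longrightarrow> x \<noteq> v \<Longrightarrow> height x \<le> height v \<Longrightarrow> \<exists>z\<in>set xs. (step_avoiding v)\<^sup>*\<^sup>* x z"
proof (induction "height x" arbitrary: x)
  case 0
  then show ?case using height_eq_0 by force
next
  case (Suc k)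
  then have "x \<notin> set xs" using height_eq_0[OF Suc.prems(1)] by simp
  then obtain y where y: "adj G x y" "height x = Suc (height y)" using ex_parent Suc.prems by blast
  then have "y \<noteq> v" using Suc.prems by auto
  then have "step_avoiding v x y" using y Suc.prems by (simp add: step_avoiding_def)
  moreover obtain z where "z \<in> set xs" "(step_avoiding v)\<^sup>*\<^sup>* y z"
    using Suc.hyps(1)[of y] Suc.hyps(2) Suc.prems y \<open>y \<noteq> v\<close> adj_verts[OF y(1)] by auto
  ultimately show ?case by (meson converse_rtranclp_into_rtranclp)
qed

lemma cycle_step_avoiding:
  assumes "v \<notin> set xs" "x \<in> set xs" "y \<in> set xs" shows "(step_avoiding v)\<^sup>*\<^sup>* x y"
proof -
  have *: "(step_avoiding v)\<^sup>*\<^sup>* (xs ! 0) (xs ! i)" if "i < length xs" for i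
    using that
  proof (induction i)
    case (Suc i)
    have "successively (adj G) xs" using path_xs by (simp add: path_def walk_def)
    then have "adj G (xs ! i) (xs ! Suc i)" using Suc.prems by (simp add: successively_conv_nth)
    moreover have "xs ! i \<noteq> v" "xs ! Suc i \<noteq> v" using assms(1) Suc.prems by (auto simp: in_set_conv_nth)
    ultimately have "step_avoiding v (xs ! i) (xs ! Suc i)" by (simp add: step_avoiding_def)
    then show ?case using Suc by simp
  qed simp
  obtain i j where "i < length xs" "x = xs ! i" "j < length xs" "y = xs ! j"
    using assms by (auto simp: in_set_conv_nth)
  with * step_avoiding_sym show ?thesis by (meson rtranclp_trans)
qed

text \<open>Two lower neighbours of \<^term>\<open>v\<close> can both be joined to the cycle avoiding \<^term>\<open>v\<close>,
  which closes a second cycle through \<^term>\<open>v\<close>.\<close>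

lemma lower_neighbour_unique:
  assumes v: "v \<in> V" "v \<notin> set xs" and u: "adj G v u" "height u \<le> height v"
    and w: "adj G v w" "height w \<le> height v"
  shows "u = w"
proof (rule ccontr)
  assume "u \<noteq> w"
  note uw = adj_verts[OF u(1)] adj_verts[OF w(1)]
  obtain y z where "y \<in> set xs" "(step_avoiding v)\<^sup>*\<^sup>* u y" "z \<in> set xs" "(step_avoiding v)\<^sup>*\<^sup>* w z"
    using descend_to_cycle u w uw by metis
  then have "(step_avoiding v)\<^sup>*\<^sup>* u w"
    using cycle_step_avoiding[OF v(2)] step_avoiding_sym by (meson rtranclp_trans)
  then obtain ys where ys: "path G ys" "hd ys = u" "last ys = w" "v \<notin> set ys"
    using step_avoiding_path uw by metis
  then obtain y z zs where "ys = y # z # zs"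
    using \<open>u \<noteq> w\<close> by (cases ys; cases "tl ys") (auto simp: path_def walk_def)
  then have "length (v # ys) \<ge> 3" "path G (v # ys)" "adj G (last (v # ys)) (hd (v # ys))"
    using ys v u(1) w(1) adj_sym by (auto simp: path_def walk_Cons)
  from only_cycle[OF this] v(2) show False by auto
qed

text \<open>A chord closes the segment between its ends to a cycle. By uniqueness this segment
  contains all of \<open>set xs\<close>, so it is the whole list.\<close>

lemma cycle_chord:
  assumes "i < j" "j < length xs" "adj G (xs ! i) (xs ! j)"
  shows "j = Suc i \<or> i = 0 \<and> Suc j = length xs"
proof (rule ccontr)
  assume *: "\<not> ?thesis"
  define ys where "ys = drop i (take (Suc j) xs)"
  have len_ys: "length ys = Suc j - i" using assms by (simp add: ys_def)
  have split: "xs = take i xs @ ys @ drop (Suc j) xs"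
    unfolding ys_def using assms
    by (metis append.assoc append_take_drop_id less_or_eq_imp_le less_Suc_eq min.absorb1 take_take)
  have ne: "ys \<noteq> []" using len_ys assms by auto
  have "path G ys"
    using path_xs ne unfolding path_def walk_def
    by (subst (asm) (1 2 3 4) split) (auto simp: successively_append_iff)
  moreover have "hd ys = xs ! i" "last ys = xs ! j"
    using assms by (auto simp: ys_def hd_drop_conv_nth last_conv_nth)
  ultimately have "set ys = set xs" using only_cycle[of ys] * len_ys assms adj_sym by auto
  then have "length ys = length xs"
    using \<open>path G ys\<close> distinct_xs by (metis distinct_card path_def)
  with len_ys * assms show False by auto
qed

text \<open>Unless both ends lie on the cycle, an end of maximal height is off the cycle, and the
  other end must be its parent by \<open>lower_neighbour_unique\<close>. That lemma admits equal
  heights, so edges within one level are covered.\<close>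

lemma adj_cases:
  assumes "adj G x y"
  shows "x \<notin> set xs \<and> parent x = y \<or> y \<notin> set xs \<and> parent y = x \<or>
    (\<exists>i<length xs. x = xs ! i \<and> y = xs ! (Suc i mod length xs) \<or>
      y = xs ! i \<and> x = xs ! (Suc i mod length xs))"
proof -
  note V = adj_verts[OF assms]
  have up: "parent x = y" if "x \<notin> set xs" "height y \<le> height x" "adj G x y" for x y
    using lower_neighbour_unique[of x "parent x" y] parent[of x] adj_verts[OF that(3)] that by simp
  have chord: "\<exists>k<length xs. x = xs ! k \<and> y = xs ! (Suc k mod length xs) \<or>
      y = xs ! k \<and> x = xs ! (Suc k mod length xs)"
    if "i < j" "j < length xs" "x = xs ! i" "y = xs ! j" "adj G x y" for i j x y
    using cycle_chord[of i j] that
    by (cases "j = Suc i") (auto intro: exI[of _ i] exI[of _ j])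
  show ?thesis
  proof (cases "x \<in> set xs \<and> y \<in> set xs")
    case True
    then obtain i j where ij: "i < length xs" "x = xs ! i" "j < length xs" "y = xs ! j"
      by (auto simp: in_set_conv_nth)
    then have "i < j \<or> j < i" using V(3) by (metis linorder_neqE_nat)
    then show ?thesis using chord[of i j x y] chord[of j i y x] ij assms adj_sym[OF assms] by blast
  next
    case False
    have "height x \<le> height y \<or> height y \<le> height x" by linarith
    with False show ?thesis
      using up[of x y] up[of y x] assms adj_sym[OF assms] height_eq_0 V
      by (metis le_zero_eq)
  qed
qed

section \<open>From the unique cycle to the abstract setting\<close>

lemma the_cycle_eq:
  assumes "\<exists>!C. is_cycle G C"
  shows "the_cycle G = UGraph (set xs) {{xs ! i, xs ! (Suc i mod length xs)} | i. i < length xs}"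
proof -
  let ?n = "length xs"
  have "insert {last xs, hd xs} {{xs ! i, xs ! Suc i} | i. Suc i < ?n}
    = {{xs ! i, xs ! (Suc i mod ?n)} | i. i < ?n}" (is "?L = ?R")
  proof (intro equalityI subsetI)
    have ne: "xs \<noteq> []" using len by auto
    then have ends: "last xs = xs ! (?n - 1)" "hd xs = xs ! (Suc (?n - 1) mod ?n)"
      by (simp_all add: last_conv_nth hd_conv_nth)
    fix e
    show "e \<in> ?R" if "e \<in> ?L"
    proof -
      from that consider "e = {last xs, hd xs}" | i where "Suc i < ?n" "e = {xs ! i, xs ! Suc i}"
        by blast
      then show ?thesis
      proof cases
        case 1
        then show ?thesis using ends len by (intro CollectI exI[of _ "?n - 1"]) auto
      next
        case 2
        then show ?thesis by (intro CollectI exI[of _ i]) auto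
      qed
    qed
    show "e \<in> ?L" if "e \<in> ?R"
    proof -
      from that obtain i where i: "i < ?n" "e = {xs ! i, xs ! (Suc i mod ?n)}" by blast
      show ?thesis
      proof (cases "Suc i = ?n")
        case True
        then have "i = ?n - 1" by simp
        then have "e = {last xs, hd xs}" using i(2) ends by simp
        then show ?thesis by blast
      next
        case False
        then show ?thesis using i by auto
      qed
    qed
  qed
  then have "is_cycle G (UGraph (set xs) ?R)"
    unfolding is_cycle_def using len path_xs closed by (intro exI[of _ xs]) simp
  with assms show ?thesis unfolding the_cycle_def by (rule the1_equality)
qed

lemma cycle_with_trees:
  assumes "\<exists>!C. is_cycle G C"
  shows "cycle_with_trees G (length xs) ((!) xs) parent height"
proof -
  have C: "(!) xs ` {..<length xs} = set xs" by (auto simp: in_set_conv_nth)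
  show ?thesis
  proof (unfold_locales, unfold C)
    show "3 \<le> length xs" by (rule len)
    show "inj_on ((!) xs) {..<length xs}" using distinct_xs by (simp add: inj_on_nth)
    show "adj G (xs ! i) (xs ! (Suc i mod length xs))" if "i < length xs" for i
    proof (cases "Suc i = length xs")
      case True
      then have "xs \<noteq> []" "i = length xs - 1" by auto
      then have "last xs = xs ! i" "hd xs = xs ! 0" by (simp_all add: last_conv_nth hd_conv_nth)
      with True closed show ?thesis by simp
    next
      case False
      with that path_xs show ?thesis by (auto simp: path_def walk_def successively_conv_nth)
    qed
    show "parent x = x" if "x \<in> set xs" for x using that by (simp add: parent_def)
  qed (use height_eq_0 parent adj_cases the_cycle_eq[OF assms] in blast)+
qed

end

theorem theorem7:
  fixes G :: "'a ugraph"
  assumes "finite_simple_graph G" and "unicyclic G"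
  defines "m \<equiv> int (thread_sum G) + max (2 - int (num_branch_active G)) 0"
  shows "(int (metric_dim G) = m \<or> int (metric_dim G) = m + 1) \<and>
         (int (edge_metric_dim G) = m \<or> int (edge_metric_dim G) = m + 1)"
proof -
  from assms(2) have conn: "connected_graph G" and unique: "\<exists>!C. is_cycle G C"
    by (auto simp: unicyclic_def)
  interpret conn_graph G using assms(1) conn by unfold_locales
  from unique obtain C where C: "is_cycle G C" by blast
  then obtain xs where xs: "length xs \<ge> 3" "path G xs" "adj G (last xs) (hd xs)"
    and C_eq: "C = UGraph (set xs)
      (insert {last xs, hd xs} {{xs ! i, xs ! Suc i} | i. Suc i < length xs})"
    unfolding is_cycle_def by blast
  have "set ys = set xs" if ys: "length ys \<ge> 3" "path G ys" "adj G (last ys) (hd ys)" for ys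
  proof -
    have "is_cycle G (UGraph (set ys)
      (insert {last ys, hd ys} {{ys ! i, ys ! Suc i} | i. Suc i < length ys}))"
      unfolding is_cycle_def using ys by blast
    with C unique have "UGraph (set ys)
      (insert {last ys, hd ys} {{ys ! i, ys ! Suc i} | i. Suc i < length ys}) = C" by blast
    then show ?thesis unfolding C_eq by simp
  qed
  then interpret unicyclic_graph G xs using xs by unfold_locales
  interpret cycle_with_trees G "length xs" "(!) xs" parent height
    using unique by (rule cycle_with_trees)
  \<comment> \<open>Truncated subtraction on naturals expresses the maximum with 0.\<close>
  have m: "m = int (thread_sum G + (2 - num_branch_active G))" by (simp add: m_def)
  show ?thesis using metric_dim_bounds edge_metric_dim_bounds unfolding m by linarith
qed

end
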